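(* Up to projective equivalence (under $\mathrm{P\Gamma L}(9,2)$) there are exactly two $3$-dimensional pseudo-ovals in $\mathrm{PG}(8,2)$, and each of them is elementary: one arises from a conic $\mathcal C$ of $\mathrm{PG}(2,8)$ and the other from a pointed conic $\mathcal{PC}$ of $\mathrm{PG}(2,8)$.
   Context: A $3$-dimensional pseudo-oval in $\mathrm{PG}(8,2)$ is a set of $9$ projective planes of $\mathrm{PG}(8,2)$ any three of which span $\mathrm{PG}(8,2)$. Identifying $\mathrm{GF}(2)^9$ with $\mathrm{GF}(8)^3$ as $\mathrm{GF}(2)$-vector spaces, each point of $\mathrm{PG}(2,8)$ becomes a plane of $\mathrm{PG}(8,2)$, and an oval of $\mathrm{PG}(2,8)$ (9 points, no three collinear) becomes a $3$-dimensional pseudo-oval, called elementary and said to arise from that oval. A conic is a nondegenerate conic of $\mathrm{PG}(2,8)$, e.g. $\{(1,t,t^{1/2}):t\in\mathrm{GF}(8)\}\cup\{(0,1,0)\}$; a pointed conic is the oval obtained from a conic by deleting one point and adding the nucleus of the conic, e.g. $\{(1,t,t^2):t\in\mathrm{GF}(8)\}\cup\{(0,1,0)\}$. *)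

theory Defs
  imports "HOL-Analysis.Finite_Cartesian_Product" "HOL-Library.Z2"
begin

text \<open>GF(2) is the library type bit.  GF(8) is modelled as bit^3 = GF(2)[x]/(x^3+x+1),
  coefficient a$0 + a$1 x + a$2 x^2.  Addition is componentwise (library).\<close>

type_synonym gf8 = "bit ^ 3"

definition gf8_mul :: "gf8 \<Rightarrow> gf8 \<Rightarrow> gf8" where
  "gf8_mul a b = (let
      d0 = a$0 * b$0;
      d1 = a$0 * b$1 + a$1 * b$0;
      d2 = a$0 * b$2 + a$1 * b$1 + a$2 * b$0;
      d3 = a$1 * b$2 + a$2 * b$1;
      d4 = a$2 * b$2
    in (\<chi> i. if i = 0 then d0 + d3 else if i = 1 then d1 + d3 + d4 else d2 + d4))"

definition gf8_one :: gf8 where "gf8_one = (\<chi> i. if i = 0 then 1 else 0)"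

definition gf8_sq :: "gf8 \<Rightarrow> gf8" where "gf8_sq t = gf8_mul t t"

definition gf8_sqrt :: "gf8 \<Rightarrow> gf8" where "gf8_sqrt t = gf8_sq (gf8_sq t)"

text \<open>The GF(2)-vector space GF(8)^3 = GF(2)^9; PG(8,2) lives on it.\<close>
type_synonym V = "gf8 ^ 3"

definition vec3 :: "gf8 \<Rightarrow> gf8 \<Rightarrow> gf8 \<Rightarrow> V" where
  "vec3 a b c = (\<chi> i. if i = 0 then a else if i = 1 then b else c)"

text \<open>A projective plane of PG(8,2) = a 3-dimensional GF(2)-subspace of GF(2)^9
  (over GF(2), subspaces are exactly additively closed sets containing 0).\<close>
definition is_plane :: "V set \<Rightarrow> bool" where
  "is_plane S \<longleftrightarrow> 0 \<in> S \<and> (\<forall>x\<in>S. \<forall>y\<in>S. x + y \<in> S) \<and> card S = 8"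

definition spans_all3 :: "V set \<Rightarrow> V set \<Rightarrow> V set \<Rightarrow> bool" where
  "spans_all3 A B C \<longleftrightarrow> {a + b + c | a b c. a \<in> A \<and> b \<in> B \<and> c \<in> C} = UNIV"

definition pseudo_oval :: "V set set \<Rightarrow> bool" where
  "pseudo_oval Ov \<longleftrightarrow> card Ov = 9 \<and> (\<forall>S\<in>Ov. is_plane S) \<and>
     (\<forall>A\<in>Ov. \<forall>B\<in>Ov. \<forall>C\<in>Ov. A \<noteq> B \<and> A \<noteq> C \<and> B \<noteq> C \<longrightarrow> spans_all3 A B C)"

text \<open>Projective equivalence under P\<Gamma>L(9,2): since GF(2) has only the trivial
  automorphism and trivial scalars, P\<Gamma>L(9,2) = GL(9,2), i.e. additive bijections.\<close>
definition proj_equiv :: "V set set \<Rightarrow> V set set \<Rightarrow> bool" where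
  "proj_equiv O1 O2 \<longleftrightarrow> (\<exists>g :: V \<Rightarrow> V. bij g \<and> (\<forall>x y. g (x + y) = g x + g y) \<and>
      O2 = (\<lambda>S. g ` S) ` O1)"

text \<open>The plane of PG(8,2) corresponding to a point P of PG(2,8): the GF(8)-span of P.\<close>
definition pt_plane :: "V \<Rightarrow> V set" where
  "pt_plane P = {(\<chi> i. gf8_mul l (P$i)) | l. True}"

definition elementary :: "V set \<Rightarrow> V set set" where
  "elementary K = pt_plane ` K"

definition conic :: "V set" where
  "conic = {vec3 gf8_one t (gf8_sqrt t) | t. True} \<union> {vec3 0 gf8_one 0}"

definition pointed_conic :: "V set" where
  "pointed_conic = {vec3 gf8_one t (gf8_sq t) | t. True} \<union> {vec3 0 gf8_one 0}"

end

theory Submission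
  imports Defs "HOL-Analysis.Cartesian_Space"
begin

text \<open>
  Take three planes of a pseudo-oval as coordinate axes and a fourth one as the diagonal of
  \<open>GF(8)\<^sup>3\<close>. The other five are graphs \<open>{(x, A x, B x)}\<close> of additive maps of \<open>GF(8)\<close>, and the
  spanning condition says that various pairs of such maps differ at every nonzero argument.
  An additive map without eigenvalues 0 and 1 has an irreducible characteristic polynomial, so a
  change of basis makes one of the \<open>A\<close>'s the multiplication by an element \<open>s\<close> of \<open>GF(8)\<close>.
  There are only 12 additive maps that differ everywhere from 0, the identity and \<open>s\<close>; five
  of them are multiplications, and each of the other seven agrees somewhere with every other
  one of the 12. Hence all \<open>A\<close>'s are multiplications. Three of the \<open>B\<close>'s, combined with the
  conditions on \<open>B A\<^sup>-\<^sup>1\<close>, likewise force all \<open>B\<close>'s to be multiplications. The pseudo-oval is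
  therefore elementary, and a search over the ovals through a frame of \<open>PG(2,8)\<close> shows that
  each of them is a conic or a pointed conic.

  The two are distinguished by their quadrangles. In characteristic 2 the diagonal points of a
  quadrangle are collinear. If the quadrangle is inscribed in a conic, their line contains the
  nucleus, so it is a tangent and meets the conic in a fifth point. A pointed conic contains
  quadrangles whose diagonal line misses all of its points.
\<close>

section \<open>Boolean groups\<close>

class boolean_group = ab_group_add +
  assumes add_self [simp]: "x + x = 0"
begin

lemma add_left_self [simp]: "x + (x + y) = y"
  by (simp flip: add.assoc)

lemma add_eq_0_iff_eq: "x + y = 0 \<longleftrightarrow> x = y"
  by (metis add_self add_left_cancel)

lemma uminus_eq_self: "- x = x"
  by (rule minus_unique) simp

lemma minus_eq_plus: "x - y = x + y"
  unfolding diff_conv_add_uminus uminus_eq_self ..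

end

instance bit :: boolean_group
  by standard simp

instance prod :: (boolean_group, boolean_group) boolean_group
  by standard (simp add: zero_prod_def split_paired_all)

instance vec :: (boolean_group, finite) boolean_group
  by standard (simp add: vec_eq_iff)

lemma additive_injI:
  assumes "additive g" "\<And>x. g x = 0 \<Longrightarrow> x = 0"
  shows "inj g"
proof (rule injI)
  interpret additive g by fact
  fix x y assume "g x = g y"
  then have "g (x - y) = 0" by (simp add: diff)
  then show "x = y" using assms(2) by fastforce
qed

lemma additive_comp: "additive f \<Longrightarrow> additive g \<Longrightarrow> additive (f \<circ> g)"
  by (simp add: additive_def)

lemma additive_inv:
  assumes "bij g" "additive g"
  shows "additive (inv g)"
proof
  fix x y
  have "g (inv g x + inv g y) = x + y"
    using assms by (simp add: additive.add bij_is_surj surj_f_inv_f)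
  then show "inv g (x + y) = inv g x + inv g y"
    using assms(1) by (metis bij_inv_eq_iff)
qed

lemma additive_map_prod: "additive f \<Longrightarrow> additive g \<Longrightarrow> additive (map_prod f g)"
  by (auto simp: additive_def)

lemma bij_map_prod: "bij f \<Longrightarrow> bij g \<Longrightarrow> bij (map_prod f g)"
  by (simp add: bij_def prod.inj_map map_prod_surj)

lemma additive_fst: "additive fst" and additive_snd: "additive snd"
  by (simp_all add: additive_def)

lemma ex_not_in_list:
  assumes "length xs < card A"
  shows "\<exists>x \<in> A. x \<notin> set xs"
  using assms card_mono[of "set xs" A] card_length[of xs] by fastforce

lemma inj_on_iff_image_eq_UNIV:
  fixes f :: "'a \<Rightarrow> 'b"
  assumes "card S = card (UNIV :: 'b set)" "card S \<noteq> 0"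
  shows "inj_on f S \<longleftrightarrow> f ` S = UNIV"
proof
  have "finite (UNIV :: 'b set)" "finite S"
    using assms by (auto intro: card_ge_0_finite)
  show "f ` S = UNIV" if "inj_on f S"
    using \<open>finite (UNIV :: 'b set)\<close> that assms(1)
    by (intro card_subset_eq) (simp_all add: card_image)
  show "inj_on f S" if "f ` S = UNIV"
    using \<open>finite S\<close> that assms(1) by (intro eq_card_imp_inj_on) simp_all
qed

section \<open>Generalised ovals\<close>

definition plane :: "'a::ab_group_add set \<Rightarrow> bool" where
  "plane S \<longleftrightarrow> 0 \<in> S \<and> (\<forall>x\<in>S. \<forall>y\<in>S. x + y \<in> S) \<and> card S = 8"

definition independent3 :: "'a::ab_group_add set \<Rightarrow> 'a set \<Rightarrow> 'a set \<Rightarrow> bool" where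
  "independent3 A B C \<longleftrightarrow> (\<forall>a\<in>A. \<forall>b\<in>B. \<forall>c\<in>C. a + b + c = 0 \<longrightarrow> a = 0 \<and> b = 0 \<and> c = 0)"

lemma plane_eqI: "plane A \<Longrightarrow> plane B \<Longrightarrow> A \<subseteq> B \<Longrightarrow> A = B"
  unfolding plane_def by (metis card.infinite card_subset_eq zero_neq_numeral)

lemma independent3_iff_inj_on:
  fixes A B C :: "'a::boolean_group set"
  assumes planes: "plane A" "plane B" "plane C"
  shows "independent3 A B C \<longleftrightarrow> inj_on (\<lambda>(a, b, c). a + b + c) (A \<times> B \<times> C)"
proof
  assume independent: "independent3 A B C"
  show "inj_on (\<lambda>(a, b, c). a + b + c) (A \<times> B \<times> C)"
  proof (rule inj_onI)
    fix s t
    assume "s \<in> A \<times> B \<times> C" "t \<in> A \<times> B \<times> C"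
      "(\<lambda>(a, b, c). a + b + c) s = (\<lambda>(a, b, c). a + b + c) t"
    moreover obtain a b c a' b' c' where st: "s = (a, b, c)" "t = (a', b', c')"
      by (cases s; cases t)
    ultimately have mem: "a \<in> A" "b \<in> B" "c \<in> C" "a' \<in> A" "b' \<in> B" "c' \<in> C"
      and eq: "a + b + c = a' + b' + c'"
      by auto
    from eq have "(a + b + c) + (a' + b' + c') = 0"
      by simp
    then have "(a + a') + (b + b') + (c + c') = 0"
      by (simp only: add_ac)
    moreover have "a + a' \<in> A" "b + b' \<in> B" "c + c' \<in> C"
      using mem planes by (simp_all add: plane_def)
    ultimately have "a + a' = 0" "b + b' = 0" "c + c' = 0"
      using independent unfolding independent3_def by blast+
    then show "s = t"
      by (simp add: st add_eq_0_iff_eq)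
  qed
next
  assume "inj_on (\<lambda>(a, b, c). a + b + c) (A \<times> B \<times> C)"
  then show "independent3 A B C"
    using planes unfolding independent3_def plane_def
    by (auto dest!: inj_onD[where y = "(0, 0, 0)"])
qed

lemma independent3_iff_spanning:
  fixes A B C :: "'a::boolean_group set"
  assumes card_UNIV: "card (UNIV :: 'a set) = 512" and planes: "plane A" "plane B" "plane C"
  shows "independent3 A B C \<longleftrightarrow> {a + b + c | a b c. a \<in> A \<and> b \<in> B \<and> c \<in> C} = UNIV"
proof -
  let ?f = "\<lambda>(a, b, c). a + b + c"
  have "card (A \<times> B \<times> C) = 512"
    using planes by (simp add: plane_def card_cartesian_product)
  then have "inj_on ?f (A \<times> B \<times> C) \<longleftrightarrow> ?f ` (A \<times> B \<times> C) = UNIV"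
    by (intro inj_on_iff_image_eq_UNIV) (simp_all add: card_UNIV)
  moreover have "{a + b + c | a b c. a \<in> A \<and> b \<in> B \<and> c \<in> C} = ?f ` (A \<times> B \<times> C)"
    by (auto simp: image_def)
  ultimately show ?thesis by (simp add: independent3_iff_inj_on[OF planes])
qed

locale generalized_oval =
  fixes Ov :: "'a::ab_group_add set set"
  assumes card_eq: "card Ov = 9"
    and plane: "S \<in> Ov \<Longrightarrow> plane S"
    and independent: "\<lbrakk>A \<in> Ov; B \<in> Ov; C \<in> Ov; A \<noteq> B; A \<noteq> C; B \<noteq> C\<rbrakk> \<Longrightarrow> independent3 A B C"

definition lin_equiv :: "'a::ab_group_add set set \<Rightarrow> 'b::ab_group_add set set \<Rightarrow> bool" where
  "lin_equiv O1 O2 \<longleftrightarrow> (\<exists>g. bij g \<and> additive g \<and> O2 = image g ` O1)"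

lemma lin_equivI: "bij g \<Longrightarrow> additive g \<Longrightarrow> O2 = image g ` O1 \<Longrightarrow> lin_equiv O1 O2"
  by (auto simp: lin_equiv_def)

lemma lin_equiv_sym:
  assumes "lin_equiv O1 O2"
  shows "lin_equiv O2 O1"
proof -
  obtain g where g: "bij g" "additive g" "O2 = image g ` O1"
    using assms by (auto simp: lin_equiv_def)
  have "O1 = image (inv g) ` O2"
    using g(1) by (simp add: g(3) image_image bij_is_inj)
  then show ?thesis
    using g by (blast intro: lin_equivI bij_imp_bij_inv additive_inv)
qed

lemma lin_equiv_trans [trans]:
  assumes "lin_equiv O1 O2" "lin_equiv O2 O3"
  shows "lin_equiv O1 O3"
proof -
  obtain g h where g: "bij g" "additive g" "O2 = image g ` O1"
    and h: "bij h" "additive h" "O3 = image h ` O2"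
    using assms by (auto simp: lin_equiv_def)
  have "O3 = image (h \<circ> g) ` O1"
    by (simp add: g(3) h(3) image_image image_comp)
  then show ?thesis
    using g(1,2) h(1,2) by (blast intro: lin_equivI bij_comp additive_comp)
qed

lemma plane_image:
  assumes "inj g" "additive g" "plane S"
  shows "plane (g ` S)"
proof -
  interpret additive g by fact
  have "0 \<in> g ` S"
    using assms(3) zero by (force simp: plane_def)
  then show ?thesis
    using assms by (auto simp: plane_def card_image inj_on_subset simp flip: add)
qed

lemma independent3_image:
  assumes "inj g" "additive g" "independent3 A B C"
  shows "independent3 (g ` A) (g ` B) (g ` C)"
proof -
  interpret additive g by fact
  have "g x = 0 \<longleftrightarrow> x = 0" for x
    using assms(1) zero by (metis injD)
  then show ?thesis
    using assms(3) by (simp add: independent3_def flip: add)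
qed

lemma generalized_oval_lin_equiv:
  assumes "lin_equiv O1 O2" "generalized_oval O1"
  shows "generalized_oval O2"
proof -
  interpret generalized_oval O1 by fact
  obtain g where g: "bij g" "additive g" "O2 = image g ` O1"
    using assms by (auto simp: lin_equiv_def)
  have "inj g" using g(1) by (rule bij_is_inj)
  then have "inj (image g)" by (simp add: inj_image_eq_iff inj_def)
  show ?thesis
  proof
    show "card O2 = 9"
      using \<open>inj (image g)\<close> by (simp add: g(3) card_image inj_on_subset card_eq)
    show "plane S" if "S \<in> O2" for S
      using that plane plane_image[OF \<open>inj g\<close> g(2)] by (auto simp: g(3))
    show "independent3 A B C"
      if "A \<in> O2" "B \<in> O2" "C \<in> O2" "A \<noteq> B" "A \<noteq> C" "B \<noteq> C" for A B C
    proof -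
      obtain A' B' C' where "A' \<in> O1" "B' \<in> O1" "C' \<in> O1" "A = g ` A'" "B = g ` B'" "C = g ` C'"
        using \<open>A \<in> O2\<close> \<open>B \<in> O2\<close> \<open>C \<in> O2\<close> g(3) by blast
      then show ?thesis
        using independent[of A' B' C'] \<open>A \<noteq> B\<close> \<open>A \<noteq> C\<close> \<open>B \<noteq> C\<close>
          independent3_image[OF \<open>inj g\<close> g(2)] by blast
    qed
  qed
qed

section \<open>The projective plane over a field\<close>

type_synonym 'a triple = "'a \<times> 'a \<times> 'a"
type_synonym 'a matrix3 = "'a triple \<times> 'a triple \<times> 'a triple"

fun smul :: "'a::comm_ring_1 \<Rightarrow> 'a triple \<Rightarrow> 'a triple" where
  "smul l (x, y, z) = (l * x, l * y, l * z)"

fun det :: "'a::comm_ring_1 triple \<Rightarrow> 'a triple \<Rightarrow> 'a triple \<Rightarrow> 'a" where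
  "det (a, b, c) (d, e, f) (g, h, i) =
     a * (e * i - f * h) - b * (d * i - f * g) + c * (d * h - e * g)"

fun lin :: "'a::comm_ring_1 matrix3 \<Rightarrow> 'a triple \<Rightarrow> 'a triple" where
  "lin (p, q, r) (x, y, z) = smul x p + smul y q + smul z r"

definition line :: "'a::comm_ring_1 triple \<Rightarrow> 'a triple set" where
  "line p = range (\<lambda>l. smul l p)"

definition arc :: "'a::comm_ring_1 triple set \<Rightarrow> bool" where
  "arc K \<longleftrightarrow> (\<forall>p\<in>K. \<forall>q\<in>K. \<forall>r\<in>K. p \<noteq> q \<and> p \<noteq> r \<and> q \<noteq> r \<longrightarrow> det p q r \<noteq> 0)"

lemma smul_add: "smul l (p + q) = smul l p + smul l q"
  by (cases p; cases q) (simp add: algebra_simps)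

lemma smul_add_left: "smul (l + m) p = smul l p + smul m p"
  by (cases p) (simp add: algebra_simps)

lemma smul_smul [simp]: "smul l (smul m p) = smul (l * m) p"
  by (cases p) (simp add: algebra_simps)

lemma smul_0 [simp]: "smul 0 p = 0" "smul l 0 = 0"
  by (cases p; simp add: zero_prod_def)+

lemma smul_1 [simp]: "smul 1 p = p"
  by (cases p) simp

lemma smul_eq_0_iff: "smul l p = 0 \<longleftrightarrow> l = 0 \<or> p = 0" for l :: "'a::field"
  by (cases p) (auto simp: zero_prod_def)

lemma additive_lin: "additive (lin M)"
  by standard (cases M rule: prod_cases3; auto simp: smul_add_left algebra_simps)

lemma lin_smul: "lin M (smul l x) = smul l (lin M x)"
  by (cases M rule: prod_cases3; cases x) (simp add: smul_add)

lemma lin_line: "lin M ` line p = line (lin M p)"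
  by (simp add: line_def image_image lin_smul)

lemma smul_in_line: "smul l p \<in> line p"
  by (simp add: line_def)

lemma line_smul:
  fixes l :: "'a::field"
  assumes "l \<noteq> 0"
  shows "line (smul l p) = line p"
proof -
  have "surj (\<lambda>m. m * l)"
    using assms by (intro surjI[of _ "\<lambda>m. m / l"]) simp
  moreover have "line (smul l p) = (\<lambda>m. smul m p) ` range (\<lambda>m. m * l)"
    by (simp add: line_def image_image)
  ultimately show ?thesis by (simp add: line_def)
qed

lemma det_independent:
  fixes a b c :: "'a::field"
  assumes "det p q r \<noteq> 0" "smul a p + smul b q + smul c r = 0"
  shows "a = 0" "b = 0" "c = 0"
proof -
  obtain x1 y1 z1 x2 y2 z2 x3 y3 z3
    where pqr: "p = (x1, y1, z1)" "q = (x2, y2, z2)" "r = (x3, y3, z3)"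
    by (cases p; cases q; cases r)
  define X Y Z where XYZ: "X = a * x1 + b * x2 + c * x3" "Y = a * y1 + b * y2 + c * y3"
    "Z = a * z1 + b * z2 + c * z3"
  have "a * det p q r = (y2 * z3 - z2 * y3) * X + (z2 * x3 - x2 * z3) * Y + (x2 * y3 - y2 * x3) * Z"
    "b * det p q r = (z1 * y3 - y1 * z3) * X + (x1 * z3 - z1 * x3) * Y + (y1 * x3 - x1 * y3) * Z"
    "c * det p q r = (y1 * z2 - z1 * y2) * X + (z1 * x2 - x1 * z2) * Y + (x1 * y2 - y1 * x2) * Z"
    by (simp_all add: pqr XYZ algebra_simps)
  moreover have "X = 0" "Y = 0" "Z = 0"
    using assms(2) by (simp_all add: pqr XYZ zero_prod_def)
  ultimately show "a = 0" "b = 0" "c = 0" using assms(1) by simp_all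
qed

lemma bij_lin:
  fixes p q r :: "'a::{field,finite} triple"
  assumes "det p q r \<noteq> 0"
  shows "bij (lin (p, q, r))"
proof -
  have "inj (lin (p, q, r))"
    using det_independent[OF assms]
    by (intro additive_injI[OF additive_lin]) (auto simp: zero_prod_def)
  then show ?thesis by (simp add: bij_def finite_UNIV_inj_surj)
qed

lemma independent3_line_iff:
  fixes p q r :: "'a::field triple"
  assumes "p \<noteq> 0" "q \<noteq> 0" "r \<noteq> 0"
  shows "independent3 (line p) (line q) (line r) \<longleftrightarrow> det p q r \<noteq> 0"
proof
  assume "det p q r \<noteq> 0"
  from det_independent[OF this] show "independent3 (line p) (line q) (line r)"
    by (fastforce simp: independent3_def line_def)
next
  assume independent: "independent3 (line p) (line q) (line r)"
  have coeffs_0: "a = 0 \<and> b = 0 \<and> c = 0" if "smul a p + smul b q + smul c r = 0" for a b c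
    using independent[unfolded independent3_def, rule_format, OF _ _ _ that]
    by (simp add: smul_in_line smul_eq_0_iff assms)
  obtain x1 y1 z1 x2 y2 z2 x3 y3 z3
    where pqr: "p = (x1, y1, z1)" "q = (x2, y2, z2)" "r = (x3, y3, z3)"
    by (cases p; cases q; cases r)
  show "det p q r \<noteq> 0"
  proof
    assume "det p q r = 0"
    then have det_0:
      "x1 * (y2 * z3 - z2 * y3) - y1 * (x2 * z3 - z2 * x3) + z1 * (x2 * y3 - y2 * x3) = 0"
      by (simp add: pqr)
    \<comment> \<open>The cofactors of each column are the coefficients of a vanishing combination.\<close>
    have "y1 * z2 - z1 * y2 = 0"
      using coeffs_0[of "y2 * z3 - z2 * y3" "z1 * y3 - y1 * z3" "y1 * z2 - z1 * y2"] det_0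
      by (simp add: pqr zero_prod_def algebra_simps)
    moreover have "x1 * z2 - z1 * x2 = 0"
      using coeffs_0[of "x2 * z3 - z2 * x3" "z1 * x3 - x1 * z3" "x1 * z2 - z1 * x2"] det_0
      by (simp add: pqr zero_prod_def algebra_simps)
    moreover have "x1 * y2 - y1 * x2 = 0"
      using coeffs_0[of "x2 * y3 - y2 * x3" "y1 * x3 - x1 * y3" "x1 * y2 - y1 * x2"] det_0
      by (simp add: pqr zero_prod_def algebra_simps)
    ultimately have "x1 = 0" "y1 = 0" "z1 = 0"
      using coeffs_0[of x2 "- x1" 0] coeffs_0[of y2 "- y1" 0] coeffs_0[of z2 "- z1" 0]
      by (simp_all add: pqr zero_prod_def algebra_simps)
    then show False using assms(1) by (simp add: pqr zero_prod_def)
  qed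
qed

fun normalize_point :: "'a::field triple \<Rightarrow> 'a triple" where
  "normalize_point (x, y, z) =
     (if x \<noteq> 0 then (1, y / x, z / x) else if y \<noteq> 0 then (0, 1, z / y) else (0, 0, 1))"

lemma line_normalize_point:
  assumes "p \<noteq> 0"
  shows "line (normalize_point p) = line p"
proof -
  obtain x y z where p: "p = (x, y, z)" by (cases p)
  define l where "l = (if x \<noteq> 0 then x else if y \<noteq> 0 then y else z)"
  have "l \<noteq> 0" "smul l (normalize_point p) = p"
    using assms by (auto simp: p l_def zero_prod_def)
  then show ?thesis using line_smul[of l "normalize_point p"] by simp
qed

lemma det_zero_left [simp]: "det 0 q r = 0"
  by (cases q; cases r) (simp add: zero_prod_def)

lemma line_neq_if_det:
  fixes p q r :: "'a::field triple"
  assumes "det p q r \<noteq> 0"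
  shows "line p \<noteq> line q"
proof
  assume "line p = line q"
  then obtain l where "p = smul l q"
    using smul_in_line[of 1 p] by (auto simp: line_def)
  then have "smul 1 p + smul (- l) q + smul 0 r = 0"
    by (simp flip: smul_add_left)
  then have "(1 :: 'a) = 0" by (rule det_independent(1)[OF assms])
  then show False by simp
qed

lemma inj_on_line_arc:
  fixes K :: "'a::field triple set"
  assumes "arc K" "3 \<le> card K"
  shows "inj_on line K"
proof (rule inj_onI, rule ccontr)
  fix p q assume "p \<in> K" "q \<in> K" "line p = line q" "p \<noteq> q"
  moreover obtain r where "r \<in> K" "r \<noteq> p" "r \<noteq> q"
    using ex_not_in_list[of "[p, q]" K] assms(2) by auto
  ultimately show False
    using assms(1) line_neq_if_det[of p q r] unfolding arc_def by metis
qed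

lemma zero_notin_arc:
  assumes "arc K" "3 \<le> card K"
  shows "0 \<notin> K"
proof
  assume "0 \<in> K"
  moreover obtain q where "q \<in> K" "q \<noteq> 0"
    using ex_not_in_list[of "[0]" K] assms(2) by auto
  moreover obtain r where "r \<in> K" "r \<noteq> 0" "r \<noteq> q"
    using ex_not_in_list[of "[0, q]" K] assms(2) by auto
  ultimately show False using assms(1) det_zero_left unfolding arc_def by metis
qed

lemma arc_if_generalized_oval:
  fixes K :: "'a::field triple set"
  assumes "generalized_oval (line ` K)" "inj_on line K" "0 \<notin> K"
  shows "arc K"
proof -
  interpret generalized_oval "line ` K" by fact
  show ?thesis
    unfolding arc_def
  proof (intro ballI impI)
    fix p q r assume "p \<in> K" "q \<in> K" "r \<in> K" "p \<noteq> q \<and> p \<noteq> r \<and> q \<noteq> r"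
    then have "independent3 (line p) (line q) (line r)"
      using assms(2) by (intro independent) (auto dest: inj_onD)
    then show "det p q r \<noteq> 0"
      using assms(3) \<open>p \<in> K\<close> \<open>q \<in> K\<close> \<open>r \<in> K\<close> independent3_line_iff by metis
  qed
qed

fun carries :: "'a::field matrix3 \<Rightarrow> 'a triple list \<Rightarrow> 'a triple list \<Rightarrow> bool" where
  "carries (p, q, r) K L \<longleftrightarrow>
     (if det p q r = 0 then False
      else find (\<lambda>x. normalize_point (lin (p, q, r) x) \<notin> set L) K = None)"

lemma lin_equiv_if_carries:
  fixes K L :: "'a::{field,finite} triple list"
  assumes "carries M K L" "0 \<notin> set K" "card (line ` set K) = card (line ` set L)"
  shows "lin_equiv (line ` set K) (line ` set L)"
proof -
  obtain p q r where M: "M = (p, q, r)" by (cases M)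
  have bij: "bij (lin M)" and normalize: "\<And>x. x \<in> set K \<Longrightarrow> normalize_point (lin M x) \<in> set L"
    using assms(1) by (auto simp: M find_None_iff bij_lin split: if_splits simp del: lin.simps)
  interpret additive "lin M" by (rule additive_lin)
  have "lin M ` line x \<in> line ` set L" if "x \<in> set K" for x
  proof -
    have "lin M x \<noteq> 0" using that assms(2) bij_is_inj[OF bij] zero by (metis injD)
    then have "lin M ` line x = line (normalize_point (lin M x))"
      by (simp add: lin_line line_normalize_point)
    then show ?thesis using normalize[OF that] by blast
  qed
  moreover have "inj (image (lin M))"
    using bij_is_inj[OF bij] by (simp add: inj_image_eq_iff inj_def)
  then have "card (image (lin M) ` line ` set K) = card (line ` set L)"
    using assms(3) by (simp add: card_image inj_on_subset)
  ultimately have "image (lin M) ` line ` set K = line ` set L"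
    by (intro card_subset_eq) auto
  then show ?thesis by (intro lin_equivI[OF bij additive_lin]) (rule sym)
qed

section \<open>The field with eight elements\<close>

datatype f8 = F bool bool bool

instantiation f8 :: enum
begin
definition "enum_f8 = [F a b c. a \<leftarrow> [False, True], b \<leftarrow> [False, True], c \<leftarrow> [False, True]]"
definition "enum_all_f8 P \<longleftrightarrow> list_all P (Enum.enum :: f8 list)"
definition "enum_ex_f8 P \<longleftrightarrow> list_ex P (Enum.enum :: f8 list)"
instance
proof
  show *: "(UNIV :: f8 set) = set Enum.enum"
  proof (intro set_eqI iffI UNIV_I)
    fix x :: f8
    obtain a b c where "x = F a b c" by (cases x)
    then show "x \<in> set Enum.enum"
      by (cases a; cases b; cases c) (simp_all add: enum_f8_def)
  qed
  show "distinct (Enum.enum :: f8 list)" by (simp add: enum_f8_def)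
  show "Enum.enum_all P = Ball UNIV P" for P :: "f8 \<Rightarrow> bool"
    by (simp add: * enum_all_f8_def list_all_iff)
  show "Enum.enum_ex P = Bex UNIV P" for P :: "f8 \<Rightarrow> bool"
    by (simp add: * enum_ex_f8_def list_ex_iff)
qed
end

instantiation f8 :: "{zero, one, plus, times, minus, uminus, inverse}"
begin
definition "0 = F False False False"
definition "1 = F True False False"
fun plus_f8 where "F a b c + F a' b' c' = F (a \<noteq> a') (b \<noteq> b') (c \<noteq> c')"
definition "- x = (x :: f8)"
definition "x - y = x + (y :: f8)"
fun times_f8 where "F a b c * F a' b' c' =
  F ((a \<and> a') \<noteq> ((b \<and> c') \<noteq> (c \<and> b')))
    ((((a \<and> b') \<noteq> (b \<and> a')) \<noteq> ((b \<and> c') \<noteq> (c \<and> b'))) \<noteq> (c \<and> c'))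
    ((((a \<and> c') \<noteq> (b \<and> b')) \<noteq> (c \<and> a')) \<noteq> (c \<and> c'))"
definition "inverse x = x * x * (x * x) * (x * (x :: f8))"
definition "x div y = x * inverse (y :: f8)"
instance ..
end

lemma f8_laws:
  "\<forall>a b c :: f8. a + b + c = a + (b + c)"
  "\<forall>a b :: f8. a + b = b + a"
  "\<forall>a b c :: f8. a * b * c = a * (b * c)"
  "\<forall>a b :: f8. a * b = b * a"
  "\<forall>a b c :: f8. (a + b) * c = a * c + b * c"
  "\<forall>a :: f8. 0 + a = a \<and> 1 * a = a \<and> - a + a = 0 \<and> a + a = 0 \<and> (a \<noteq> 0 \<longrightarrow> inverse a * a = 1)"
  "0 \<noteq> (1 :: f8)" "inverse 0 = (0 :: f8)"
  by code_simp+

instance f8 :: field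
  by intro_classes (use f8_laws in \<open>auto simp: minus_f8_def uminus_f8_def divide_f8_def\<close>)

instance f8 :: boolean_group
  by intro_classes (use f8_laws in auto)

lemma card_f8: "card (UNIV :: f8 set) = 8"
  by (simp add: card_UNIV_length_enum enum_f8_def)

lemma f8_power_8: "(x * x) * (x * x) * ((x * x) * (x * x)) = x" for x :: f8
proof -
  have "\<forall>x :: f8. (x * x) * (x * x) * ((x * x) * (x * x)) = x" by code_simp
  then show ?thesis ..
qed

abbreviation alpha :: f8 where "alpha \<equiv> F False True False"

lemma plane_range:
  fixes f :: "f8 \<Rightarrow> 'a::ab_group_add"
  assumes "additive f" "inj f"
  shows "plane (range f)"
proof -
  have "card (range f) = 8"
    using assms(2) by (simp add: card_image card_f8)
  moreover have "0 \<in> range f"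
    by (metis additive.zero[OF assms(1)] rangeI)
  ultimately show ?thesis
    by (auto simp: plane_def simp flip: additive.add[OF assms(1)])
qed

lemma plane_line:
  fixes p :: "f8 triple"
  assumes "p \<noteq> 0"
  shows "plane (line p)"
  unfolding line_def
proof (rule plane_range)
  show "additive (\<lambda>l. smul l p)"
    by standard (rule smul_add_left)
  then show "inj (\<lambda>l. smul l p)"
    by (rule additive_injI) (simp add: smul_eq_0_iff assms)
qed

lemma generalized_oval_arc:
  fixes K :: "f8 triple set"
  assumes "arc K" "card K = 9"
  shows "generalized_oval (line ` K)"
proof
  have "3 \<le> card K" using assms(2) by simp
  then have "inj_on line K" "0 \<notin> K" using inj_on_line_arc zero_notin_arc assms(1) by blast+
  then show "card (line ` K) = 9" using assms(2) by (simp add: card_image)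
  show "plane S" if "S \<in> line ` K" for S
    using that \<open>0 \<notin> K\<close> plane_line by (metis imageE)
  show "independent3 A B C"
    if mem: "A \<in> line ` K" "B \<in> line ` K" "C \<in> line ` K" and "A \<noteq> B" "A \<noteq> C" "B \<noteq> C" for A B C
  proof -
    obtain p q r where pqr: "p \<in> K" "q \<in> K" "r \<in> K" "A = line p" "B = line q" "C = line r"
      using mem by blast
    then have "p \<noteq> q" "p \<noteq> r" "q \<noteq> r" using \<open>A \<noteq> B\<close> \<open>A \<noteq> C\<close> \<open>B \<noteq> C\<close> by auto
    then have "det p q r \<noteq> 0" using assms(1) pqr(1-3) by (auto simp: arc_def simp del: det.simps)
    moreover have "p \<noteq> 0" "q \<noteq> 0" "r \<noteq> 0" using pqr(1-3) \<open>0 \<notin> K\<close> by auto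
    ultimately show ?thesis unfolding pqr(4-6) by (simp add: independent3_line_iff)
  qed
qed

section \<open>Additive maps of the field\<close>

fun basis_map :: "'a::ab_group_add triple \<Rightarrow> f8 \<Rightarrow> 'a" where
  "basis_map (u, v, w) (F a b c) =
     (if a then u else 0) + (if b then v else 0) + (if c then w else 0)"

lemma additive_basis_map:
  fixes p :: "'a::boolean_group triple"
  shows "additive (basis_map p)"
proof
  fix x y
  obtain u v w where p: "p = (u, v, w)" by (cases p)
  obtain a b c a' b' c' where xy: "x = F a b c" "y = F a' b' c'" by (cases x; cases y)
  show "basis_map p (x + y) = basis_map p x + basis_map p y"
    unfolding p xy plus_f8.simps basis_map.simps
    by (cases a; cases b; cases c; cases a'; cases b'; cases c'; simp add: add_ac)
qed

lemma additive_eq_basis_map: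
  fixes A :: "f8 \<Rightarrow> 'a::ab_group_add"
  assumes "additive A"
  shows "A = basis_map (A 1, A alpha, A (alpha * alpha))"
proof
  interpret additive A by fact
  fix x
  obtain a b c where x: "x = F a b c" by (cases x)
  have "x = (if a then 1 else 0) + (if b then alpha else 0) + (if c then alpha * alpha else 0)"
    unfolding x by (cases a; cases b; cases c) (simp_all add: one_f8_def zero_f8_def)
  then have "A x =
      A (if a then 1 else 0) + A (if b then alpha else 0) + A (if c then alpha * alpha else 0)"
    by (simp only: add)
  then show "A x = basis_map (A 1, A alpha, A (alpha * alpha)) x"
    unfolding x basis_map.simps by (simp only: if_distrib[of A] zero)
qed

lemma plane_parametrization:
  fixes S :: "'a::boolean_group set"
  assumes "plane S"
  obtains f :: "f8 \<Rightarrow> 'a" where "additive f" "inj f" "range f = S"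
proof -
  have "0 \<in> S" "card S = 8" and add_mem: "\<And>x y. x \<in> S \<Longrightarrow> y \<in> S \<Longrightarrow> x + y \<in> S"
    using assms by (auto simp: plane_def)
  obtain u where u: "u \<in> S" "u \<noteq> 0"
    using ex_not_in_list[of "[0]" S] \<open>card S = 8\<close> by auto
  obtain v where v: "v \<in> S" "v \<noteq> 0" "v \<noteq> u"
    using ex_not_in_list[of "[0, u]" S] \<open>card S = 8\<close> by auto
  obtain w where w: "w \<in> S" "w \<noteq> 0" "w \<noteq> u" "w \<noteq> v" "w \<noteq> u + v"
    using ex_not_in_list[of "[0, u, v, u + v]" S] \<open>card S = 8\<close> by auto
  define f where "f = basis_map (u, v, w)"
  have "additive f" unfolding f_def by (rule additive_basis_map)
  moreover have "inj f"
  proof (rule additive_injI[OF \<open>additive f\<close>])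
    fix x assume "f x = 0"
    then show "x = 0"
      using u(2) v(2,3) w(2-5) unfolding f_def
      by (cases x) (auto simp: zero_f8_def add_eq_0_iff_eq split: if_splits)
  qed
  moreover have "f x \<in> S" for x
    using \<open>0 \<in> S\<close> u(1) v(1) w(1) add_mem by (cases x) (simp add: f_def)
  then have "range f = S"
    using plane_range[OF \<open>additive f\<close> \<open>inj f\<close>] assms by (intro plane_eqI) auto
  ultimately show ?thesis by (rule that)
qed

definition disagree :: "('a::zero \<Rightarrow> 'b) \<Rightarrow> ('a \<Rightarrow> 'b) \<Rightarrow> bool" where
  "disagree f g \<longleftrightarrow> (\<forall>x. x \<noteq> 0 \<longrightarrow> f x \<noteq> g x)"

lemma additive_mult: "additive ((*) t)" for t :: "'a::ring"
  by standard (rule distrib_left)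

lemma bij_if_disagree_0:
  fixes f :: "f8 \<Rightarrow> f8"
  assumes "additive f" "disagree f ((*) 0)"
  shows "bij f"
proof -
  have "inj f" using assms by (intro additive_injI) (auto simp: disagree_def)
  then show ?thesis by (simp add: bij_def finite_UNIV_inj_surj)
qed

text \<open>The searches are evaluated by rewriting, which evaluates both sides of a conjunction, does
  not share the values of local definitions and works under binders. Conditionals and \<^const>\<open>find\<close>
  end a branch early, auxiliary functions force their arguments, and matching on \<^const>\<open>F\<close>
  protects bodies with symbolic arguments from being unfolded.\<close>

lemma disagree_code [code]:
  "disagree f g \<longleftrightarrow> find (\<lambda>x. x \<noteq> 0 \<and> f x = g x) Enum.enum = None"
  for f :: "'a::{enum,zero} \<Rightarrow> 'b"
  by (auto simp: disagree_def find_None_iff enum_UNIV)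

definition scalar :: "f8 triple \<Rightarrow> bool" where
  "scalar p \<longleftrightarrow> (\<forall>x. basis_map p x = basis_map p 1 * x)"

definition eigenvalue_free :: "f8 \<Rightarrow> f8 triple list" where
  "eigenvalue_free s =
     filter (\<lambda>p. find (\<lambda>u. \<not> disagree (basis_map p) ((*) u)) [0, 1, s] = None) Enum.enum"

definition nonscalars_isolated :: "f8 triple list \<Rightarrow> bool" where
  "nonscalars_isolated ps \<longleftrightarrow>
     (\<forall>p \<in> set ps. if scalar p then True else \<forall>q \<in> set ps. \<not> disagree (basis_map p) (basis_map q))"

lemma nonscalars_isolated_eigenvalue_free:
  "\<forall>s. if s \<in> {0, 1} then True else nonscalars_isolated (eigenvalue_free s)"
  by code_simp

lemma set_eigenvalue_free:
  "p \<in> set (eigenvalue_free s) \<longleftrightarrow> (\<forall>u \<in> {0, 1, s}. disagree (basis_map p) ((*) u))"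
  by (auto simp: eigenvalue_free_def find_None_iff enum_UNIV)

lemma scalarD: "scalar p \<Longrightarrow> basis_map p = (*) (basis_map p 1)"
  unfolding scalar_def by blast

lemma mult_if_disagree:
  fixes A B :: "f8 \<Rightarrow> f8"
  assumes "s \<notin> {0, 1}" "additive A" "additive B"
    and A: "\<forall>u \<in> {0, 1, s}. disagree A ((*) u)" and B: "\<forall>u \<in> {0, 1, s}. disagree B ((*) u)"
    and "disagree A B"
  shows "\<exists>t. A = (*) t"
proof -
  obtain p q where pq: "A = basis_map p" "B = basis_map q"
    using additive_eq_basis_map assms(2,3) by blast
  have "nonscalars_isolated (eigenvalue_free s)"
    using nonscalars_isolated_eigenvalue_free assms(1) by metis
  moreover have "p \<in> set (eigenvalue_free s)" "q \<in> set (eigenvalue_free s)"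
    using A B by (simp_all add: set_eigenvalue_free pq)
  ultimately have "scalar p"
    using \<open>disagree A B\<close> unfolding nonscalars_isolated_def pq by metis
  then show ?thesis using scalarD pq(1) by blast
qed

text \<open>A pair \<open>(s, p)\<close> stands for the graph of \<open>\<lambda>x. (s * x, basis_map p x)\<close>.\<close>

fun compatible :: "f8 \<times> f8 triple \<Rightarrow> f8 \<times> f8 triple \<Rightarrow> bool" where
  "compatible (s, p) (t, q) \<longleftrightarrow>
     (if s = t then False
      else if disagree (basis_map p) (basis_map q)
      then disagree (basis_map p \<circ> (*) t) (basis_map q \<circ> (*) s) else False)"

definition pairwise_incompatible :: "(f8 \<times> f8 triple) list \<Rightarrow> bool" where
  "pairwise_incompatible ps \<longleftrightarrow> (\<forall>p \<in> set ps. \<forall>q \<in> set ps. \<not> compatible p q)"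

definition nonscalars_in_no_triangle :: "(f8 \<times> f8 triple) list \<Rightarrow> bool" where
  "nonscalars_in_no_triangle ps \<longleftrightarrow> (\<forall>p \<in> set ps. if scalar (snd p) then True
     else pairwise_incompatible (filter (compatible p) ps))"

definition eigenvalue_free_graphs :: "(f8 \<times> f8 triple) list" where
  "eigenvalue_free_graphs =
     [(s, p). s \<leftarrow> filter (\<lambda>s. s \<notin> {0, 1}) Enum.enum, p \<leftarrow> eigenvalue_free s]"

lemma nonscalars_in_no_triangle_eigenvalue_free_graphs:
  "nonscalars_in_no_triangle eigenvalue_free_graphs"
  by code_simp

lemma eigenvalue_free_graphsI:
  assumes "s \<notin> {0, 1}" "\<forall>u \<in> {0, 1, s}. disagree (basis_map p) ((*) u)"
  shows "(s, p) \<in> set eigenvalue_free_graphs"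
  using assms by (auto simp: eigenvalue_free_graphs_def set_eigenvalue_free enum_UNIV)

lemma scalar_if_compatible_triangle:
  assumes "a \<in> set eigenvalue_free_graphs" "b \<in> set eigenvalue_free_graphs"
      "c \<in> set eigenvalue_free_graphs"
    and "compatible a b" "compatible a c" "compatible b c"
  shows "scalar (snd a)"
proof (rule ccontr)
  assume "\<not> scalar (snd a)"
  then have "pairwise_incompatible (filter (compatible a) eigenvalue_free_graphs)"
    using nonscalars_in_no_triangle_eigenvalue_free_graphs assms(1)
    unfolding nonscalars_in_no_triangle_def by metis
  then show False using assms(2-6) unfolding pairwise_incompatible_def set_filter by blast
qed

text \<open>If \<open>A\<close> satisfies \<open>(A + c)\<^sup>3 = (A + c) + 1\<close>, then this map conjugates \<open>A + c\<close> to the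
  multiplication by \<^const>\<open>alpha\<close>.\<close>

definition power_basis :: "(f8 \<Rightarrow> f8) \<Rightarrow> f8 \<Rightarrow> f8 \<Rightarrow> f8" where
  "power_basis A c = basis_map (1, A 1 + c, A (A 1) + c)"

lemma basis_map_conjugate_mult:
  "\<forall>p. if disagree (basis_map p) ((*) 0) \<and> disagree (basis_map p) ((*) 1)
     then \<exists>c \<in> {0, 1}. disagree (power_basis (basis_map p) c) ((*) 0) \<and>
       (\<forall>x. basis_map p (power_basis (basis_map p) c x) =
          power_basis (basis_map p) c ((alpha + c) * x))
     else True"
  by code_simp

lemma additive_conjugate_mult:
  fixes A :: "f8 \<Rightarrow> f8"
  assumes "additive A" "disagree A ((*) 0)" "disagree A ((*) 1)"
  obtains j :: "f8 \<Rightarrow> f8" and s where "s \<notin> {0, 1}" "additive j" "bij j" "A \<circ> j = j \<circ> (*) s"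
proof -
  obtain p where p: "A = basis_map p" using additive_eq_basis_map[OF assms(1)] by blast
  obtain c where "c \<in> {0, 1}" and c: "disagree (power_basis A c) ((*) 0)"
    "\<And>x. A (power_basis A c x) = power_basis A c ((alpha + c) * x)"
    using basis_map_conjugate_mult assms(2,3) unfolding p by metis
  have "alpha + c \<notin> {0, 1}"
    using \<open>c \<in> {0, 1}\<close> by (auto simp: zero_f8_def one_f8_def)
  moreover have "additive (power_basis A c)"
    unfolding power_basis_def by (rule additive_basis_map)
  moreover from this have "bij (power_basis A c)" using c(1) by (rule bij_if_disagree_0)
  moreover have "A \<circ> power_basis A c = power_basis A c \<circ> (*) (alpha + c)"
    using c(2) by (simp add: fun_eq_iff)
  ultimately show ?thesis by (rule that)
qed

section \<open>Ovals of the plane over the field\<close>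

definition conic_points :: "f8 triple list" where
  "conic_points = (0, 1, 0) # map (\<lambda>t. (1, t, (t * t) * (t * t))) Enum.enum"

definition pointed_conic_points :: "f8 triple list" where
  "pointed_conic_points = (0, 1, 0) # map (\<lambda>t. (1, t, t * t)) Enum.enum"

lemma set_conic_points:
  "set conic_points = insert (0, 1, 0) (range (\<lambda>t. (1, t, (t * t) * (t * t))))"
  by (simp add: conic_points_def enum_UNIV)

lemma set_pointed_conic_points:
  "set pointed_conic_points = insert (0, 1, 0) (range (\<lambda>t. (1, t, t * t)))"
  by (simp add: pointed_conic_points_def enum_UNIV)

lemma arc_conic_points: "arc (set conic_points)" "card (set conic_points) = 9"
  by code_simp+

lemma arc_pointed_conic_points:
  "arc (set pointed_conic_points)" "card (set pointed_conic_points) = 9"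
  by code_simp+

fun extends_arc :: "f8 triple \<Rightarrow> f8 triple list \<Rightarrow> bool" where
  "extends_arc p [] \<longleftrightarrow> True"
| "extends_arc p (q # K) \<longleftrightarrow>
     (if find (\<lambda>r. det p q r = 0) K = None then extends_arc p K else False)"

lemma extends_arc_if_arc:
  assumes "arc (insert p (set K))" "distinct (p # K)"
  shows "extends_arc p K"
  using assms
proof (induction K)
  case (Cons q K)
  have "det p q r \<noteq> 0" if "r \<in> set K" for r
    using Cons.prems that unfolding arc_def by (metis distinct.simps(2) insertCI list.set_intros)
  then have "find (\<lambda>r. det p q r = 0) K = None"
    by (simp add: find_None_iff)
  moreover have "extends_arc p K"
    using Cons.prems by (intro Cons.IH) (auto simp: arc_def)
  ultimately show ?case by simp
qed simp

fun extends_arc_strict :: "f8 triple \<Rightarrow> f8 triple list \<Rightarrow> bool" where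
  "extends_arc_strict (x, y, F a b c) K \<longleftrightarrow> extends_arc (x, y, F a b c) K"

fun all_arc_extensions :: "(f8 triple list \<Rightarrow> bool) \<Rightarrow> f8 triple list \<Rightarrow> f8 list \<Rightarrow> bool" where
  "all_arc_extensions P K [] \<longleftrightarrow> P K"
| "all_arc_extensions P K (t # ts) \<longleftrightarrow>
     (\<forall>y. if extends_arc_strict (1, t, y) K then all_arc_extensions P ((1, t, y) # K) ts else True)"

definition affine_point :: "(f8 \<Rightarrow> f8) \<Rightarrow> f8 \<Rightarrow> f8 triple" where
  "affine_point f t = (1, t, f t)"

lemma all_arc_extensionsD:
  assumes "all_arc_extensions P K ts" "distinct (K @ map (affine_point f) ts)"
    and "arc (set K \<union> affine_point f ` set ts)"
  shows "\<exists>K'. P K' \<and> set K' = set K \<union> affine_point f ` set ts"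
  using assms
proof (induction ts arbitrary: K)
  case Nil
  then show ?case by auto
next
  case (Cons t ts)
  have "extends_arc (affine_point f t) K"
    using Cons.prems(2,3) by (intro extends_arc_if_arc) (auto simp: arc_def)
  then have "extends_arc_strict (1, t, f t) K"
    by (cases "f t") (simp add: affine_point_def)
  then have "all_arc_extensions P (affine_point f t # K) ts"
    using Cons.prems(1) unfolding affine_point_def by (metis all_arc_extensions.simps(2))
  moreover have "distinct ((affine_point f t # K) @ map (affine_point f) ts)"
    "arc (set (affine_point f t # K) \<union> affine_point f ` set ts)"
    using Cons.prems(2,3) by auto
  ultimately show ?case using Cons.IH[of "affine_point f t # K"] by simp
qed

text \<open>The columns of the matrix that takes the unit points to \<open>p\<close>, \<open>q\<close>, \<open>r\<close> and \<open>(1, 1, 1)\<close>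
  to \<open>s\<close>, by Cramer's rule.\<close>

definition frame_matrix ::
    "'a::comm_ring_1 triple \<Rightarrow> 'a triple \<Rightarrow> 'a triple \<Rightarrow> 'a triple \<Rightarrow> 'a matrix3" where
  "frame_matrix p q r s = (smul (det s q r) p, smul (det p s r) q, smul (det p q s) r)"

text \<open>Nine points \<open>K\<close> of the form \<open>(0, 1, 0)\<close>, \<open>(0, 0, 1)\<close>, \<open>(1, t, f t)\<close> for \<open>t \<noteq> m\<close> extend to a
  hyperoval by \<open>Q = (1, m, n)\<close>, where \<open>n\<close> is the ordinate that is not yet taken: all
  elements of the field add up to \<open>0\<close>. Either \<open>Q\<close> is the nucleus of a conic, or some point \<open>N\<close>
  of \<open>K\<close> is the nucleus of the conic formed by the other nine points of the hyperoval.\<close>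

definition is_conic_or_pointed_conic :: "f8 triple list \<Rightarrow> bool" where
  "is_conic_or_pointed_conic K \<longleftrightarrow> (let Q = sum_list K + (0, 1, 1) in
     if case K of p # q # r # _ \<Rightarrow> carries (frame_matrix p q Q r) conic_points K then True
     else find (\<lambda>N. case remove1 N K of
       p # r # _ \<Rightarrow> carries (frame_matrix p N Q r) pointed_conic_points K) K \<noteq> None)"

lemma is_conic_or_pointed_conicD:
  assumes "is_conic_or_pointed_conic K" "3 \<le> length K"
  shows "\<exists>M. carries M conic_points K \<or> carries M pointed_conic_points K"
proof -
  define Q where "Q = sum_list K + (0, 1, 1)"
  obtain p q r K' where K: "K = p # q # r # K'"
    using assms(2) by (auto simp: numeral_3_eq_3 Suc_le_length_iff)
  consider "carries (frame_matrix p q Q r) conic_points K"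
    | N where "case remove1 N K of
        p # r # _ \<Rightarrow> carries (frame_matrix p N Q r) pointed_conic_points K"
    using assms(1) unfolding is_conic_or_pointed_conic_def Let_def Q_def[symmetric]
    by (auto simp only: K list.case find_None_iff not_not split: if_splits)
  then show ?thesis
  proof cases
    case (2 N)
    moreover obtain p' r' K'' where "remove1 N K = p' # r' # K''"
      by (metis K remove1.simps(2))
    ultimately show ?thesis by (metis list.simps(5))
  qed blast
qed

definition framed_points :: "f8 \<Rightarrow> (f8 \<Rightarrow> f8) \<Rightarrow> f8 triple set" where
  "framed_points m f = {(0, 1, 0), (0, 0, 1)} \<union> affine_point f ` (- {m})"

lemma card_framed_points: "card (framed_points m f) = 9"
proof -
  have "inj_on (affine_point f) (- {m})" by (simp add: inj_on_def affine_point_def)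
  then have "card (affine_point f ` (- {m})) = 7"
    by (simp add: card_image Compl_eq_Diff_UNIV card_f8)
  then show ?thesis
    unfolding framed_points_def by (subst card_Un_disjoint) (auto simp: affine_point_def)
qed

definition frame :: "f8 triple list" where
  "frame = [(1, 0, 0), (0, 1, 0), (0, 0, 1), (1, 1, 1)]"

lemma all_arc_extensions_frame:
  "\<forall>m. if m \<in> {0, 1} then True
     else all_arc_extensions is_conic_or_pointed_conic frame (filter (\<lambda>t. t \<notin> {0, 1, m}) Enum.enum)"
  by code_simp

lemma framed_arc_lin_equiv:
  assumes "arc (framed_points m f)" "m \<notin> {0, 1}" "f 0 = 0" "f 1 = 1"
  shows "lin_equiv (line ` framed_points m f) (line ` set conic_points) \<or>
    lin_equiv (line ` framed_points m f) (line ` set pointed_conic_points)"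
proof -
  define ts where "ts = filter (\<lambda>t. t \<notin> {0, 1, m}) Enum.enum"
  have "- {m} = {0, 1} \<union> set ts"
    using assms(2) by (auto simp: ts_def enum_UNIV)
  then have points: "framed_points m f = set frame \<union> affine_point f ` set ts"
    by (auto simp: framed_points_def affine_point_def frame_def assms(3,4))
  have "all_arc_extensions is_conic_or_pointed_conic frame ts"
    using all_arc_extensions_frame assms(2) unfolding ts_def by metis
  moreover have "distinct (frame @ map (affine_point f) ts)"
    by (auto simp: frame_def affine_point_def ts_def distinct_map enum_distinct inj_on_def)
  moreover have "arc (set frame \<union> affine_point f ` set ts)"
    using assms(1) by (simp only: points)
  ultimately obtain K where K: "is_conic_or_pointed_conic K" "set K = framed_points m f"
    using all_arc_extensionsD[of is_conic_or_pointed_conic frame ts f] unfolding points by blast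
  then have "3 \<le> length K" using card_length[of K] by (simp add: card_framed_points)
  then obtain M where "carries M conic_points K \<or> carries M pointed_conic_points K"
    using is_conic_or_pointed_conicD K(1) by blast
  moreover have "card (line ` L) = 9 \<and> 0 \<notin> L" if "arc L" "card L = 9" for L :: "f8 triple set"
    using that inj_on_line_arc[of L] zero_notin_arc[of L] by (simp add: card_image)
  ultimately have "lin_equiv (line ` set conic_points) (line ` framed_points m f) \<or>
      lin_equiv (line ` set pointed_conic_points) (line ` framed_points m f)"
    using lin_equiv_if_carries K(2) arc_conic_points arc_pointed_conic_points assms(1)
      card_framed_points by metis
  then show ?thesis using lin_equiv_sym by blast
qed

section \<open>Coordinates\<close>

abbreviation X_axis :: "f8 triple set" where "X_axis \<equiv> line (1, 0, 0)"
abbreviation Y_axis :: "f8 triple set" where "Y_axis \<equiv> line (0, 1, 0)"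
abbreviation Z_axis :: "f8 triple set" where "Z_axis \<equiv> line (0, 0, 1)"

definition graph :: "(f8 \<Rightarrow> f8) \<Rightarrow> (f8 \<Rightarrow> f8) \<Rightarrow> f8 triple set" where
  "graph A B = range (\<lambda>x. (x, A x, B x))"

lemma in_graph: "(x, A x, B x) \<in> graph A B"
  by (simp add: graph_def)

lemma graph_inject: "graph A B = graph A' B' \<longleftrightarrow> A = A' \<and> B = B'"
proof
  assume "graph A B = graph A' B'"
  then have "(x, A x, B x) \<in> graph A' B'" for x
    using in_graph[of x A B] by simp
  then show "A = A' \<and> B = B'" by (auto simp: graph_def)
qed simp

lemma mult_inject: "(*) s = (*) t \<longleftrightarrow> s = t" for s t :: "'a::monoid_mult"
  by (metis mult.right_neutral)

lemma graph_mult: "graph ((*) s) ((*) t) = line (1, s, t)"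
  by (simp add: graph_def line_def mult.commute)

lemma in_axes: "(x, 0, 0) \<in> X_axis" "(0, x, 0) \<in> Y_axis" "(0, 0, x) \<in> Z_axis"
  using smul_in_line[of x "(1, 0, 0)"] smul_in_line[of x "(0, 1, 0)"] smul_in_line[of x "(0, 0, 1)"]
  by simp_all

lemma axes_neq: "X_axis \<noteq> Y_axis" "X_axis \<noteq> Z_axis" "Y_axis \<noteq> Z_axis"
  using line_neq_if_det[of "(1, 0, 0)" "(0, 1, 0)" "(0, 0, 1 :: f8)"]
    line_neq_if_det[of "(1, 0, 0)" "(0, 0, 1)" "(0, 1, 0 :: f8)"]
    line_neq_if_det[of "(0, 1, 0)" "(0, 0, 1)" "(1, 0, 0 :: f8)"] by simp_all

lemma graph_neq_axes: "graph A B \<noteq> Y_axis" "graph A B \<noteq> Z_axis"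
  using in_graph[of 1 A B] by (auto simp: line_def)

lemma plane_eq_graphE:
  assumes "plane S" "independent3 S Y_axis Z_axis"
  obtains A B where "additive A" "additive B" "S = graph A B"
proof -
  obtain f :: "f8 \<Rightarrow> f8 triple" where f: "additive f" "inj f" "range f = S"
    using assms(1) by (rule plane_parametrization)
  define u where "u = fst \<circ> f"
  have "additive u"
    unfolding u_def using additive_fst f(1) by (rule additive_comp)
  have "inj u"
  proof (rule additive_injI[OF \<open>additive u\<close>])
    fix x assume "u x = 0"
    then obtain y z where fx: "f x = (0, y, z)" by (cases "f x") (simp add: u_def)
    then have "f x + (0, y, 0) + (0, 0, z) = 0" by (simp add: zero_prod_def)
    then have "f x = 0"
      using assms(2) f(3) in_axes unfolding independent3_def by blast
    then show "x = 0" using f(1,2) by (metis additive.zero injD)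
  qed
  then have "bij u" by (simp add: bij_def finite_UNIV_inj_surj)
  define h where "h = f \<circ> inv u"
  have "additive h"
    unfolding h_def using f(1) additive_inv[OF \<open>bij u\<close> \<open>additive u\<close>] by (rule additive_comp)
  have fst_h: "fst (h x) = x" for x
    using surj_f_inv_f[OF bij_is_surj[OF \<open>bij u\<close>]] by (simp add: h_def u_def)
  have "S = f ` range (inv u)"
    using bij_is_surj[OF bij_imp_bij_inv[OF \<open>bij u\<close>]] f(3) by simp
  also have "\<dots> = range h"
    by (simp only: h_def image_comp)
  also have "\<dots> = graph (fst \<circ> (snd \<circ> h)) (snd \<circ> (snd \<circ> h))"
    unfolding graph_def using fst_h by (metis (no_types, lifting) comp_apply prod.collapse)
  finally show ?thesis
    using that additive_comp additive_fst additive_snd \<open>additive h\<close> by metis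
qed

lemma disagree_if_independent_Z:
  assumes "independent3 (graph A B) (graph A' B') Z_axis"
  shows "disagree A A'"
  unfolding disagree_def
proof (intro allI impI notI)
  fix x assume "x \<noteq> 0" "A x = A' x"
  then have "(x, A x, B x) + (x, A' x, B' x) + (0, 0, B x + B' x) = 0"
    by (simp add: zero_prod_def)
  then have "(x, A x, B x) = 0"
    using assms in_graph in_axes(3) unfolding independent3_def by blast
  then show False using \<open>x \<noteq> 0\<close> by (simp add: zero_prod_def)
qed

lemma disagree_if_independent_Y:
  assumes "independent3 (graph A B) (graph A' B') Y_axis"
  shows "disagree B B'"
  unfolding disagree_def
proof (intro allI impI notI)
  fix x assume "x \<noteq> 0" "B x = B' x"
  then have "(x, A x, B x) + (x, A' x, B' x) + (0, A x + A' x, 0) = 0"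
    by (simp add: zero_prod_def)
  then have "(x, A x, B x) = 0"
    using assms in_graph in_axes(2) unfolding independent3_def by blast
  then show False using \<open>x \<noteq> 0\<close> by (simp add: zero_prod_def)
qed

lemma disagree_if_independent_X:
  assumes "independent3 (graph ((*) s) B) (graph ((*) t) C) X_axis" "t \<noteq> 0"
  shows "disagree (B \<circ> (*) t) (C \<circ> (*) s)"
  unfolding disagree_def
proof (intro allI impI notI)
  fix z assume "z \<noteq> 0" "(B \<circ> (*) t) z = (C \<circ> (*) s) z"
  then have "(t * z, s * (t * z), B (t * z)) + (s * z, t * (s * z), C (s * z)) +
      (t * z + s * z, 0, 0) = 0"
    by (simp add: zero_prod_def mult.left_commute)
  then have "(t * z, s * (t * z), B (t * z)) = 0"
    using assms(1) in_graph in_axes(1) unfolding independent3_def by blast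
  then show False using \<open>z \<noteq> 0\<close> \<open>t \<noteq> 0\<close> by (simp add: zero_prod_def)
qed

lemma map_prod_axes:
  fixes f g h :: "f8 \<Rightarrow> f8"
  assumes "surj f" "surj g" "surj h" "f 0 = 0" "g 0 = 0" "h 0 = 0"
  defines "k \<equiv> map_prod f (map_prod g h)"
  shows "k ` X_axis = X_axis" "k ` Y_axis = Y_axis" "k ` Z_axis = Z_axis"
proof -
  have "range (\<lambda>l. e (j l)) = range e" if "surj j" for j :: "f8 \<Rightarrow> f8" and e :: "f8 \<Rightarrow> f8 triple"
    using that by (metis image_image)
  then show "k ` X_axis = X_axis" "k ` Y_axis = Y_axis" "k ` Z_axis = Z_axis"
    using assms(1-6) by (simp_all add: k_def line_def image_image)
qed

lemma map_prod_graph: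
  assumes "bij f"
  shows "map_prod f (map_prod g h) ` graph A B = graph (g \<circ> A \<circ> inv f) (h \<circ> B \<circ> inv f)"
proof -
  have "graph (g \<circ> A \<circ> inv f) (h \<circ> B \<circ> inv f) =
      (\<lambda>x. (x, g (A (inv f x)), h (B (inv f x)))) ` range f"
    using bij_is_surj[OF assms] by (simp add: graph_def)
  also have "\<dots> = map_prod f (map_prod g h) ` graph A B"
    using bij_is_inj[OF assms] by (simp add: graph_def image_image)
  finally show ?thesis ..
qed

section \<open>Generalised ovals through a frame\<close>

locale framed_oval = generalized_oval Ov for Ov :: "f8 triple set set" +
  assumes axes: "X_axis \<in> Ov" "Y_axis \<in> Ov" "Z_axis \<in> Ov"
    and diagonal: "line (1, 1, 1) \<in> Ov"
begin

definition maps :: "((f8 \<Rightarrow> f8) \<times> (f8 \<Rightarrow> f8)) set" where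
  "maps = {(A, B). additive A \<and> additive B \<and> graph A B \<in> Ov}"

lemma additive_maps: "(A, B) \<in> maps \<Longrightarrow> additive A" "(A, B) \<in> maps \<Longrightarrow> additive B"
  by (simp_all add: maps_def)

lemma graph_maps: "(A, B) \<in> maps \<Longrightarrow> graph A B \<in> Ov"
  by (simp add: maps_def)

lemma mult_in_maps_iff: "((*) s, (*) t) \<in> maps \<longleftrightarrow> line (1, s, t) \<in> Ov"
  by (simp add: maps_def graph_mult additive_mult)

lemma zero_in_maps: "((*) 0, (*) 0) \<in> maps" and one_in_maps: "((*) 1, (*) 1) \<in> maps"
  using axes(1) diagonal by (simp_all add: mult_in_maps_iff)

lemma Ov_eq_axes_Un_graphs: "Ov = {Y_axis, Z_axis} \<union> (\<lambda>(A, B). graph A B) ` maps"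
proof (intro equalityI subsetI)
  fix S assume "S \<in> Ov"
  show "S \<in> {Y_axis, Z_axis} \<union> (\<lambda>(A, B). graph A B) ` maps"
  proof (rule ccontr)
    assume S: "S \<notin> {Y_axis, Z_axis} \<union> (\<lambda>(A, B). graph A B) ` maps"
    then have "independent3 S Y_axis Z_axis"
      using \<open>S \<in> Ov\<close> axes axes_neq by (intro independent) auto
    then obtain A B where "additive A" "additive B" "S = graph A B"
      using plane[OF \<open>S \<in> Ov\<close>] plane_eq_graphE by blast
    then have "(A, B) \<in> maps" using \<open>S \<in> Ov\<close> by (simp add: maps_def)
    then show False using S \<open>S = graph A B\<close> by force
  qed
next
  fix S assume "S \<in> {Y_axis, Z_axis} \<union> (\<lambda>(A, B). graph A B) ` maps"
  then show "S \<in> Ov" using axes graph_maps by auto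
qed

lemma card_maps: "card maps = 7"
proof -
  have "inj_on (\<lambda>(A, B). graph A B) maps"
    by (auto simp: inj_on_def graph_inject)
  then have "card ((\<lambda>(A, B). graph A B) ` maps) = card maps"
    by (rule card_image)
  moreover have "{Y_axis, Z_axis} \<inter> (\<lambda>(A, B). graph A B) ` maps = {}"
    using graph_neq_axes by fastforce
  moreover have "finite Ov"
    using card_eq by (metis card.infinite zero_neq_numeral)
  ultimately have "card Ov = card {Y_axis, Z_axis} + card maps"
    using Ov_eq_axes_Un_graphs by (metis card_Un_disjoint finite_Un)
  then show ?thesis using card_eq axes_neq by simp
qed

lemma disagree_maps:
  assumes "(A, B) \<in> maps" "(A', B') \<in> maps" "(A, B) \<noteq> (A', B')"
  shows "disagree A A'" "disagree B B'"
proof -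
  have "graph A B \<noteq> graph A' B'"
    using assms(3) by (simp add: graph_inject)
  then have "independent3 (graph A B) (graph A' B') S" if "S \<in> {Y_axis, Z_axis}" for S
    using that graph_maps assms(1,2) graph_neq_axes axes by (intro independent) auto
  then show "disagree A A'" "disagree B B'"
    by (auto intro: disagree_if_independent_Y disagree_if_independent_Z)
qed

lemma fst_maps_inject:
  assumes "(A, B) \<in> maps" "(A, B') \<in> maps"
  shows "B = B'"
proof (rule ccontr)
  assume "B \<noteq> B'"
  then have "disagree A A" using disagree_maps(1)[OF assms] by simp
  then have "1 = (0 :: f8)" unfolding disagree_def by blast
  then show False by simp
qed

lemma disagree_ratio:
  assumes "((*) s, B) \<in> maps" "((*) t, C) \<in> maps" "s \<noteq> t" "s \<noteq> 0" "t \<noteq> 0"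
  shows "disagree (B \<circ> (*) t) (C \<circ> (*) s)"
proof (rule disagree_if_independent_X)
  have "X_axis = graph ((*) 0) ((*) 0)" by (simp add: graph_mult)
  then show "independent3 (graph ((*) s) B) (graph ((*) t) C) X_axis"
    using assms graph_maps axes(1) by (intro independent) (simp_all add: graph_inject mult_inject)
qed fact

lemma maps_eq_mult_if_trivial_slope:
  assumes "((*) s, B) \<in> maps" "s \<in> {0, 1}"
  shows "B = (*) s"
  using assms fst_maps_inject zero_in_maps one_in_maps by blast

lemma eigenvalue_free_maps:
  assumes "((*) s, B) \<in> maps" "s \<notin> {0, 1}"
  shows "\<forall>u \<in> {0, 1, s}. disagree B ((*) u)"
proof -
  have "((*) s, B) \<noteq> ((*) 0, (*) 0)" "((*) s, B) \<noteq> ((*) 1, (*) 1)"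
    using assms(2) by (auto simp: mult_inject)
  then have "disagree B ((*) 0)" "disagree B ((*) 1)"
    using disagree_maps(2)[OF assms(1)] zero_in_maps one_in_maps by blast+
  moreover have "disagree B ((*) s)"
    using disagree_ratio[OF assms(1) one_in_maps] assms(2) by (simp add: comp_def disagree_def)
  ultimately show ?thesis by simp
qed

lemma compatible_maps:
  assumes "((*) s, basis_map p) \<in> maps" "((*) t, basis_map q) \<in> maps" "s \<noteq> t" "s \<noteq> 0" "t \<noteq> 0"
  shows "compatible (s, p) (t, q)"
  using disagree_maps(2)[OF assms(1,2)] disagree_ratio[OF assms] assms(3) by (simp add: mult_inject)

end

lemma sum_of_independent_parametrizations:
  fixes p q r :: "f8 \<Rightarrow> 'a::boolean_group"
  defines "h \<equiv> \<lambda>(a, b, c). p a + q b + r c"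
  assumes "card (UNIV :: 'a set) = 512"
    and p: "additive p" "inj p" and q: "additive q" "inj q" and r: "additive r" "inj r"
    and independent: "independent3 (range p) (range q) (range r)"
  shows "additive h" "bij h" "h ` X_axis = range p" "h ` Y_axis = range q" "h ` Z_axis = range r"
proof -
  note add = additive.add[OF p(1)] additive.add[OF q(1)] additive.add[OF r(1)]
  note zero = additive.zero[OF p(1)] additive.zero[OF q(1)] additive.zero[OF r(1)]
  show "additive h"
    by standard (auto simp: h_def add add_ac)
  have "inj h"
  proof (rule additive_injI[OF \<open>additive h\<close>])
    fix x assume "h x = 0"
    moreover obtain a b c where x: "x = (a, b, c)" by (cases x)
    ultimately have "p a = 0 \<and> q b = 0 \<and> r c = 0"
      using independent unfolding independent3_def by (auto simp: h_def)
    then have "a = 0 \<and> b = 0 \<and> c = 0"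
      using zero p(2) q(2) r(2) by (metis injD)
    then show "x = 0" by (simp add: x zero_prod_def)
  qed
  moreover have "card (UNIV :: f8 triple set) = card (UNIV :: 'a set)"
    using assms(2) by (simp add: card_f8 flip: UNIV_Times_UNIV)
  ultimately show "bij h"
    using assms(2) inj_on_iff_image_eq_UNIV[of "UNIV :: f8 triple set" h] by (simp add: bij_def)
  show "h ` X_axis = range p" "h ` Y_axis = range q" "h ` Z_axis = range r"
    by (simp_all add: line_def image_image h_def zero)
qed

lemma ex_lin_equiv_axes:
  fixes Ov :: "'a::boolean_group set set"
  assumes "card (UNIV :: 'a set) = 512" "generalized_oval Ov"
  shows "\<exists>Ov'. lin_equiv Ov Ov' \<and> {X_axis, Y_axis, Z_axis} \<subseteq> Ov'"
proof -
  interpret generalized_oval Ov by fact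
  obtain P where "P \<in> Ov"
    using ex_not_in_list[of "[]" Ov] card_eq by auto
  obtain Q where "Q \<in> Ov" "Q \<noteq> P"
    using ex_not_in_list[of "[P]" Ov] card_eq by auto
  obtain R where "R \<in> Ov" "R \<noteq> P" "R \<noteq> Q"
    using ex_not_in_list[of "[P, Q]" Ov] card_eq by auto
  obtain p :: "f8 \<Rightarrow> 'a" where p: "additive p" "inj p" "range p = P"
    using plane[OF \<open>P \<in> Ov\<close>] by (rule plane_parametrization)
  obtain q :: "f8 \<Rightarrow> 'a" where q: "additive q" "inj q" "range q = Q"
    using plane[OF \<open>Q \<in> Ov\<close>] by (rule plane_parametrization)
  obtain r :: "f8 \<Rightarrow> 'a" where r: "additive r" "inj r" "range r = R"
    using plane[OF \<open>R \<in> Ov\<close>] by (rule plane_parametrization)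
  have "independent3 (range p) (range q) (range r)"
    unfolding p(3) q(3) r(3)
    using \<open>P \<in> Ov\<close> \<open>Q \<in> Ov\<close> \<open>R \<in> Ov\<close> \<open>Q \<noteq> P\<close> \<open>R \<noteq> P\<close> \<open>R \<noteq> Q\<close> independent by metis
  note h = sum_of_independent_parametrizations[OF assms(1) p(1,2) q(1,2) r(1,2) this,
      unfolded p(3) q(3) r(3)]
  let ?h = "\<lambda>(a, b, c). p a + q b + r c"
  have "X_axis = inv ?h ` P" "Y_axis = inv ?h ` Q" "Z_axis = inv ?h ` R"
    using h(3-5) bij_is_inj[OF h(2)] by (metis image_inv_f_f)+
  then have "{X_axis, Y_axis, Z_axis} \<subseteq> image (inv ?h) ` Ov"
    using \<open>P \<in> Ov\<close> \<open>Q \<in> Ov\<close> \<open>R \<in> Ov\<close> by blast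
  then show ?thesis
    using lin_equivI[OF bij_imp_bij_inv[OF h(2)] additive_inv[OF h(2,1)] refl] by blast
qed

lemma framed_oval_map_prod_image:
  assumes "generalized_oval Ov" "{X_axis, Y_axis, Z_axis, graph A B} \<subseteq> Ov"
    and f: "bij f" "additive f" and g: "bij g" "additive g" and h: "bij h" "additive h"
    and "g \<circ> A \<circ> inv f = (*) 1" "h \<circ> B \<circ> inv f = (*) 1"
  defines "k \<equiv> map_prod f (map_prod g h)"
  shows "lin_equiv Ov (image k ` Ov)" "framed_oval (image k ` Ov)"
proof -
  show equiv: "lin_equiv Ov (image k ` Ov)"
    unfolding k_def using f g h by (intro lin_equivI[OF _ _ refl] bij_map_prod additive_map_prod)
  have "k ` X_axis = X_axis" "k ` Y_axis = Y_axis" "k ` Z_axis = Z_axis"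
    unfolding k_def using f g h by (simp_all add: map_prod_axes bij_is_surj additive.zero)
  moreover have "k ` graph A B = line (1, 1, 1)"
    unfolding k_def map_prod_graph[OF f(1)] assms(9,10) graph_mult ..
  ultimately have "X_axis \<in> image k ` Ov" "Y_axis \<in> image k ` Ov" "Z_axis \<in> image k ` Ov"
    "line (1, 1, 1) \<in> image k ` Ov"
    using assms(2) by (metis image_eqI insert_subset)+
  then show "framed_oval (image k ` Ov)"
    using generalized_oval_lin_equiv[OF equiv assms(1)]
    by (simp add: framed_oval_def framed_oval_axioms_def)
qed

lemma mult_1_eq_id: "(*) 1 = (id :: 'a::monoid_mult \<Rightarrow> 'a)"
  by auto

lemma ex_lin_equiv_framed:
  fixes Ov :: "'a::boolean_group set set"
  assumes "card (UNIV :: 'a set) = 512" "generalized_oval Ov"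
  shows "\<exists>Ov'. lin_equiv Ov Ov' \<and> framed_oval Ov'"
proof -
  obtain O1 where O1: "lin_equiv Ov O1" "{X_axis, Y_axis, Z_axis} \<subseteq> O1"
    using ex_lin_equiv_axes[OF assms] by blast
  interpret generalized_oval O1
    using O1(1) assms(2) by (rule generalized_oval_lin_equiv)
  obtain S where S: "S \<in> O1" "S \<noteq> X_axis" "S \<noteq> Y_axis" "S \<noteq> Z_axis"
    using ex_not_in_list[of "[X_axis, Y_axis, Z_axis]" O1] card_eq by auto
  have "independent3 S Y_axis Z_axis"
    using S O1(2) axes_neq by (intro independent) auto
  then obtain A B where AB: "additive A" "additive B" "S = graph A B"
    using plane[OF S(1)] plane_eq_graphE by blast
  have "independent3 S X_axis Y_axis" "independent3 S X_axis Z_axis"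
    using S O1(2) axes_neq by (auto intro!: independent)
  moreover have "X_axis = graph ((*) 0) ((*) 0)" by (simp add: graph_mult)
  ultimately have "disagree A ((*) 0)" "disagree B ((*) 0)"
    unfolding AB(3) using disagree_if_independent_Y disagree_if_independent_Z by metis+
  then have "bij A" "bij B" using AB(1,2) bij_if_disagree_0 by blast+
  have "lin_equiv O1 (image (map_prod id (map_prod (inv A) (inv B))) ` O1)"
    "framed_oval (image (map_prod id (map_prod (inv A) (inv B))) ` O1)"
    using \<open>bij A\<close> \<open>bij B\<close> AB S(1) O1(2) generalized_oval_axioms
    by (auto intro!: framed_oval_map_prod_image[where A = A and B = B] bij_imp_bij_inv additive_inv
        simp: mult_1_eq_id bij_is_inj additive_def)
  then show ?thesis using O1(1) lin_equiv_trans by blast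
qed

locale framed_mult_oval = framed_oval +
  fixes s B\<^sub>0
  assumes slope: "s \<notin> {0, 1}" and slope_in_maps: "((*) s, B\<^sub>0) \<in> maps"
begin

lemma fst_maps_eq_mult:
  assumes "(A, B) \<in> maps"
  shows "\<exists>t. A = (*) t"
proof (cases "(A, B) \<in> set [((*) 0, (*) 0), ((*) 1, (*) 1), ((*) s, B\<^sub>0)]")
  case False
  let ?known = "[((*) 0, (*) 0), ((*) 1, (*) 1), ((*) s, B\<^sub>0)]"
  obtain A' B' where A': "(A', B') \<in> maps" "(A', B') \<notin> set ((A, B) # ?known)"
    using ex_not_in_list[of "(A, B) # ?known" maps] card_maps by auto
  have "disagree C ((*) u)"
    if "u \<in> {0, 1, s}" "(C, D) \<in> maps" "(C, D) \<notin> set ?known" for u C D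
    using that disagree_maps(1)[OF that(2)] zero_in_maps one_in_maps slope_in_maps by auto
  moreover have "disagree A A'"
    using assms A' by (auto intro!: disagree_maps(1))
  ultimately show ?thesis
    using slope assms A' False additive_maps(1) by (intro mult_if_disagree[of s A A']) auto
qed auto

definition slopes :: "f8 set" where
  "slopes = {t. \<exists>B. ((*) t, B) \<in> maps}"

lemma card_slopes: "card slopes = 7"
proof -
  have "fst ` maps = (*) ` slopes"
    using fst_maps_eq_mult by (force simp: slopes_def)
  moreover have "inj_on fst maps"
    using fst_maps_inject by (auto simp: inj_on_def)
  moreover have "inj_on (*) slopes"
    by (simp add: inj_on_def mult_inject)
  ultimately show ?thesis
    using card_maps by (metis card_image)
qed

lemma snd_maps_eq_mult:
  assumes "((*) t, B) \<in> maps"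
  shows "\<exists>y. B = (*) y"
proof (cases "t \<in> {0, 1}")
  case True
  then show ?thesis using maps_eq_mult_if_trivial_slope[OF assms] by blast
next
  case False
  obtain u where u: "u \<in> slopes" "u \<notin> {0, 1, t}"
    using ex_not_in_list[of "[0, 1, t]" slopes] card_slopes by auto
  obtain v where v: "v \<in> slopes" "v \<notin> {0, 1, t, u}"
    using ex_not_in_list[of "[0, 1, t, u]" slopes] card_slopes by auto
  obtain C D where C: "((*) u, C) \<in> maps" and D: "((*) v, D) \<in> maps"
    using u(1) v(1) by (auto simp: slopes_def)
  obtain p q r where pqr: "B = basis_map p" "C = basis_map q" "D = basis_map r"
    using additive_eq_basis_map additive_maps(2) assms C D by metis
  have "(t, p) \<in> set eigenvalue_free_graphs" "(u, q) \<in> set eigenvalue_free_graphs"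
    "(v, r) \<in> set eigenvalue_free_graphs"
    using False u(2) v(2) assms C D eigenvalue_free_maps unfolding pqr
    by (auto intro!: eigenvalue_free_graphsI)
  moreover have "compatible (t, p) (u, q)" "compatible (t, p) (v, r)" "compatible (u, q) (v, r)"
    using False u(2) v(2) assms C D unfolding pqr
    by (auto intro!: compatible_maps simp del: compatible.simps)
  ultimately have "scalar (snd (t, p))" by (rule scalar_if_compatible_triangle)
  then have "B = (*) (basis_map p 1)" unfolding snd_conv pqr(1) by (rule scalarD)
  then show ?thesis ..
qed

lemma Ov_eq_framed_pointsE:
  obtains m f where "m \<notin> {0, 1}" "f 0 = 0" "f 1 = 1" "Ov = line ` framed_points m f"
proof -
  have "card (- slopes) = 1"
    using card_slopes by (simp add: Compl_eq_Diff_UNIV card_Diff_subset card_f8 finite_subset)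
  then obtain m where m: "slopes = - {m}"
    by (metis card_1_singletonE double_complement)
  have "\<exists>y. ((*) t, (*) y) \<in> maps" if "t \<in> slopes" for t
    using that snd_maps_eq_mult unfolding slopes_def by blast
  then obtain f where f: "\<And>t. t \<in> slopes \<Longrightarrow> ((*) t, (*) (f t)) \<in> maps" by metis
  have maps_eq: "maps = (\<lambda>t. ((*) t, (*) (f t))) ` slopes"
  proof (intro equalityI subsetI)
    fix g assume "g \<in> maps"
    moreover obtain A B where g: "g = (A, B)" by (cases g)
    ultimately obtain t where t: "A = (*) t" using fst_maps_eq_mult by blast
    then have "t \<in> slopes" using \<open>g \<in> maps\<close> g by (auto simp: slopes_def)
    then have "B = (*) (f t)" using f fst_maps_inject \<open>g \<in> maps\<close> unfolding g t by blast
    then show "g \<in> (\<lambda>t. ((*) t, (*) (f t))) ` slopes" using \<open>t \<in> slopes\<close> g t by blast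
  qed (use f in auto)
  have "Ov = line ` framed_points m f"
    by (subst Ov_eq_axes_Un_graphs) (simp add: maps_eq framed_points_def affine_point_def m
        image_Un image_image graph_mult)
  moreover have trivial_slopes: "0 \<in> slopes" "1 \<in> slopes"
    using zero_in_maps one_in_maps by (auto simp: slopes_def)
  then have "f 0 = 0" "f 1 = 1"
    using fst_maps_inject[OF f[of 0] zero_in_maps] fst_maps_inject[OF f[of 1] one_in_maps]
    by (simp_all add: mult_inject)
  moreover have "m \<notin> {0, 1}" using trivial_slopes m by auto
  ultimately show ?thesis using that by blast
qed

lemma lin_equiv_conic_or_pointed_conic:
  "lin_equiv Ov (line ` set conic_points) \<or> lin_equiv Ov (line ` set pointed_conic_points)"
proof -
  obtain m f where m: "m \<notin> {0, 1}" "f 0 = 0" "f 1 = 1" and Ov: "Ov = line ` framed_points m f"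
    by (rule Ov_eq_framed_pointsE)
  have "finite (framed_points m f)" by (simp add: framed_points_def)
  then have "inj_on line (framed_points m f)"
    using card_eq unfolding Ov by (intro eq_card_imp_inj_on) (simp_all add: card_framed_points)
  moreover have "0 \<notin> framed_points m f"
    by (auto simp: framed_points_def affine_point_def zero_prod_def)
  ultimately have "arc (framed_points m f)"
    using generalized_oval_axioms unfolding Ov by (intro arc_if_generalized_oval)
  then show ?thesis unfolding Ov using m by (rule framed_arc_lin_equiv)
qed

end

lemma (in framed_oval) ex_lin_equiv_framed_mult:
  "\<exists>Ov' s B. lin_equiv Ov Ov' \<and> framed_mult_oval Ov' s B"
proof -
  obtain A B where AB: "(A, B) \<in> maps" "(A, B) \<notin> set [((*) 0, (*) 0), ((*) 1, (*) 1)]"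
    using ex_not_in_list[of "[((*) 0, (*) 0), ((*) 1, (*) 1)]" maps] card_maps by auto
  then have "disagree A ((*) 0)" "disagree A ((*) 1)"
    using disagree_maps(1)[OF AB(1)] zero_in_maps one_in_maps by auto
  then obtain j :: "f8 \<Rightarrow> f8" and s where "s \<notin> {0, 1}"
    and j: "additive j" "bij j" "A \<circ> j = j \<circ> (*) s"
    using additive_conjugate_mult additive_maps(1)[OF AB(1)] by blast
  define i where "i = inv j"
  have i: "bij i" "additive i" "inv i = j" "i \<circ> j = id"
    unfolding i_def using j(1,2)
    by (simp_all add: bij_imp_bij_inv additive_inv inv_inv_eq bij_is_inj)
  define k where "k = map_prod i (map_prod i i)"
  have frame: "{X_axis, Y_axis, Z_axis, graph ((*) 1) ((*) 1)} \<subseteq> Ov"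
    using axes diagonal by (simp add: graph_mult)
  have conjugate_1: "i \<circ> (*) 1 \<circ> inv i = (*) 1"
    by (simp add: mult_1_eq_id i(3,4))
  note equiv_framed = framed_oval_map_prod_image[OF generalized_oval_axioms frame
      i(1,2) i(1,2) i(1,2) conjugate_1 conjugate_1, folded k_def]
  have "i \<circ> A \<circ> j = (*) s"
    by (metis j(3) i(4) comp_assoc id_comp)
  then have "k ` graph A B = graph ((*) s) (i \<circ> B \<circ> j)"
    unfolding k_def map_prod_graph[OF i(1)] i(3) by simp
  then have "graph ((*) s) (i \<circ> B \<circ> j) \<in> image k ` Ov"
    using graph_maps[OF AB(1)] by (metis image_eqI)
  moreover have "additive (i \<circ> B \<circ> j)"
    using additive_comp i(2) j(1) additive_maps(2)[OF AB(1)] by blast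
  ultimately have "((*) s, i \<circ> B \<circ> j) \<in> framed_oval.maps (image k ` Ov)"
    by (simp add: framed_oval.maps_def[OF equiv_framed(2)] additive_mult)
  then have "framed_mult_oval (image k ` Ov) s (i \<circ> B \<circ> j)"
    using equiv_framed(2) \<open>s \<notin> {0, 1}\<close>
    by (simp add: framed_mult_oval_def framed_mult_oval_axioms_def)
  then show ?thesis using equiv_framed(1) by blast
qed

lemma generalized_oval_classification:
  fixes Ov :: "'a::boolean_group set set"
  assumes "card (UNIV :: 'a set) = 512" "generalized_oval Ov"
  shows "lin_equiv Ov (line ` set conic_points) \<or> lin_equiv Ov (line ` set pointed_conic_points)"
proof -
  obtain O1 where O1: "lin_equiv Ov O1" "framed_oval O1"
    using ex_lin_equiv_framed[OF assms] by blast
  obtain O2 s B where O2: "lin_equiv O1 O2" "framed_mult_oval O2 s B"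
    using framed_oval.ex_lin_equiv_framed_mult[OF O1(2)] by blast
  then show ?thesis
    using framed_mult_oval.lin_equiv_conic_or_pointed_conic O1(1) lin_equiv_trans by metis
qed

section \<open>Quadrangles and their diagonal lines\<close>

text \<open>Here \<open>p + q\<close> ranges over \<open>(P + Q) \<inter> (R + S)\<close> and \<open>p' + r'\<close> over \<open>(P + R) \<inter> (Q + S)\<close>:
  these are two diagonal points of the quadrangle, and in characteristic 2 the third one is
  collinear with them.\<close>

definition on_diagonal_line ::
    "'a::ab_group_add set \<Rightarrow> 'a set \<Rightarrow> 'a set \<Rightarrow> 'a set \<Rightarrow> 'a set \<Rightarrow> bool" where
  "on_diagonal_line E P Q R S \<longleftrightarrow>
     (\<exists>p\<in>P. \<exists>q\<in>Q. \<exists>r\<in>R. \<exists>s\<in>S. \<exists>p'\<in>P. \<exists>q'\<in>Q. \<exists>r'\<in>R. \<exists>s'\<in>S.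
        p + q + r + s = 0 \<and> p' + q' + r' + s' = 0 \<and> p + q + p' + r' \<in> E \<and> p + q + p' + r' \<noteq> 0)"

definition diagonally_closed :: "'a::ab_group_add set set \<Rightarrow> bool" where
  "diagonally_closed Ov \<longleftrightarrow> (\<forall>P\<in>Ov. \<forall>Q\<in>Ov. \<forall>R\<in>Ov. \<forall>S\<in>Ov. distinct [P, Q, R, S] \<longrightarrow>
     (\<exists>E\<in>Ov. on_diagonal_line E P Q R S))"

lemma on_diagonal_lineI:
  assumes "p \<in> P" "q \<in> Q" "r \<in> R" "s \<in> S" "p' \<in> P" "q' \<in> Q" "r' \<in> R" "s' \<in> S"
    "p + q + r + s = 0" "p' + q' + r' + s' = 0" "p + q + p' + r' \<in> E" "p + q + p' + r' \<noteq> 0"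
  shows "on_diagonal_line E P Q R S"
  unfolding on_diagonal_line_def using assms by (intro bexI conjI)

lemma on_diagonal_line_image:
  assumes "inj g" "additive g" "on_diagonal_line E P Q R S"
  shows "on_diagonal_line (g ` E) (g ` P) (g ` Q) (g ` R) (g ` S)"
proof -
  interpret additive g by fact
  obtain p q r s p' q' r' s' where
    mem: "p \<in> P" "q \<in> Q" "r \<in> R" "s \<in> S" "p' \<in> P" "q' \<in> Q" "r' \<in> R" "s' \<in> S"
    and sums: "p + q + r + s = 0" "p' + q' + r' + s' = 0"
      "p + q + p' + r' \<in> E" "p + q + p' + r' \<noteq> 0"
    using assms(3) unfolding on_diagonal_line_def by blast
  have "g p + g q + g p' + g r' \<noteq> 0"
    unfolding add[symmetric] using sums(4) assms(1) zero by (metis injD)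
  then show ?thesis
    using mem sums
    by (intro on_diagonal_lineI[of "g p" _ "g q" _ "g r" _ "g s" _ "g p'" "g q'" "g r'" "g s'"])
      (simp_all add: zero flip: add)
qed

lemma diagonally_closed_lin_equiv:
  assumes "lin_equiv O1 O2" "diagonally_closed O1"
  shows "diagonally_closed O2"
  unfolding diagonally_closed_def
proof (intro ballI impI)
  obtain g where g: "inj g" "additive g" and O2: "O2 = image g ` O1"
    using assms(1) bij_is_inj unfolding lin_equiv_def by metis
  fix P Q R S assume "P \<in> O2" "Q \<in> O2" "R \<in> O2" "S \<in> O2" and distinct: "distinct [P, Q, R, S]"
  then obtain P' Q' R' S' where "P' \<in> O1" "Q' \<in> O1" "R' \<in> O1" "S' \<in> O1"
    and images: "P = g ` P'" "Q = g ` Q'" "R = g ` R'" "S = g ` S'"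
    unfolding O2 by (elim imageE)
  moreover have "distinct [P', Q', R', S']"
    using distinct distinct_map[of "image g" "[P', Q', R', S']"]
    by (simp only: images list.map simp_thms)
  ultimately obtain E where "E \<in> O1" "on_diagonal_line E P' Q' R' S'"
    using assms(2) unfolding diagonally_closed_def by blast
  then show "\<exists>E\<in>O2. on_diagonal_line E P Q R S"
    using on_diagonal_line_image[OF g] unfolding O2 images by blast
qed

fun conic_point :: "'a::comm_ring_1 \<times> 'a \<Rightarrow> 'a triple" where
  "conic_point (u, v) = (u * u, v * v, u * v)"

fun bracket :: "'a::comm_ring_1 \<times> 'a \<Rightarrow> 'a \<times> 'a \<Rightarrow> 'a" where
  "bracket (u, v) (u', v') = u * v' - v * u'"

lemma bracket_neq_0:
  fixes w w' :: "'a::field \<times> 'a"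
  assumes "line (conic_point w) \<noteq> line (conic_point w')" "w \<noteq> 0" "w' \<noteq> 0"
  shows "bracket w w' \<noteq> 0"
proof
  assume "bracket w w' = 0"
  obtain u v u' v' where w: "w = (u, v)" "w' = (u', v')" by (cases w; cases w')
  define l where "l = (if u \<noteq> 0 then u' / u else v' / v)"
  have "l \<noteq> 0" "u' = l * u" "v' = l * v"
    using \<open>bracket w w' = 0\<close> assms(2,3) by (auto simp: w l_def zero_prod_def field_simps)
  then have "conic_point w' = smul (l * l) (conic_point w)"
    by (simp add: w mult_ac)
  then show False using assms(1) \<open>l \<noteq> 0\<close> by (simp add: line_smul)
qed

lemmas boolean_ring_simps = distrib_left distrib_right mult_ac add_ac add_0_left add_0_right
  add_self add_left_self minus_eq_plus

lemma conic_point_relation: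
  fixes w1 w2 w3 w4 :: "'a::{comm_ring_1,boolean_group} \<times> 'a"
  shows "smul (bracket w2 w3 * bracket w2 w4 * bracket w3 w4) (conic_point w1) +
    smul (bracket w1 w3 * bracket w1 w4 * bracket w3 w4) (conic_point w2) +
    smul (bracket w1 w2 * bracket w1 w4 * bracket w2 w4) (conic_point w3) +
    smul (bracket w1 w2 * bracket w1 w3 * bracket w2 w3) (conic_point w4) = 0"
  by (cases w1; cases w2; cases w3; cases w4)
    (simp only: conic_point.simps bracket.simps smul.simps add_Pair zero_prod_def
      boolean_ring_simps)

lemma det_conic_points_nucleus:
  fixes w w' :: "'a::{comm_ring_1,boolean_group} \<times> 'a"
  shows "det (conic_point w) (conic_point w') (0, 0, 1) = bracket w w' * bracket w w'"
  by (cases w; cases w')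
    (simp only: conic_point.simps bracket.simps det.simps boolean_ring_simps
      mult_zero_left mult_zero_right mult_1_left mult_1_right)

text \<open>The line through the two diagonal points contains the nucleus \<open>(0, 0, 1)\<close> of the conic.\<close>

lemma conic_diagonal_points:
  fixes w1 w2 w3 w4 :: "'a::{comm_ring_1,boolean_group} \<times> 'a"
  obtains x y z z' where
    "smul (bracket w2 w3 * bracket w2 w4) (conic_point w1) +
      smul (bracket w1 w3 * bracket w1 w4) (conic_point w2) = smul (bracket w1 w2) (x, y, z)"
    "smul (bracket w2 w3 * bracket w3 w4) (conic_point w1) +
      smul (bracket w1 w2 * bracket w1 w4) (conic_point w3) = smul (bracket w1 w3) (x, y, z')"
    "z + z' = bracket w1 w4 * bracket w2 w3"
proof -
  obtain u1 v1 u2 v2 u3 v3 u4 v4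
    where w: "w1 = (u1, v1)" "w2 = (u2, v2)" "w3 = (u3, v3)" "w4 = (u4, v4)"
    by (cases w1; cases w2; cases w3; cases w4)
  let ?x = "v1 * u2 * u3 * u4 + u1 * v2 * u3 * u4 + u1 * u2 * v3 * u4 + u1 * u2 * u3 * v4"
  let ?y = "u1 * v2 * v3 * v4 + v1 * u2 * v3 * v4 + v1 * v2 * u3 * v4 + v1 * v2 * v3 * u4"
  let ?z = "u1 * u2 * v3 * v4 + v1 * v2 * u3 * u4" and ?z' = "u1 * u3 * v2 * v4 + v1 * v3 * u2 * u4"
  show ?thesis
    by (rule that[of ?x ?y ?z ?z']; simp only: w conic_point.simps bracket.simps smul.simps add_Pair
        boolean_ring_simps)
qed

lemma conic_chord_avoids_nucleus:
  fixes w w' :: "'a::{field,boolean_group} \<times> 'a"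
  assumes "bracket w w' \<noteq> 0" "a \<noteq> 0"
    and "smul a (conic_point w) + smul b (conic_point w') = smul c (x, y, z)"
  shows "(x, y) \<noteq> 0"
proof
  assume "(x, y) = 0"
  then have "smul a (conic_point w) + smul b (conic_point w') + smul (c * z) (0, 0, 1) = 0"
    using assms(3) by (simp add: zero_prod_def)
  moreover have "det (conic_point w) (conic_point w') (0, 0, 1) \<noteq> 0"
    using assms(1) by (simp add: det_conic_points_nucleus)
  ultimately show False using det_independent(1) assms(2) by blast
qed

lemma on_diagonal_line_if_relation:
  assumes "smul k1 p1 + smul k2 p2 + smul k3 p3 + smul k4 p4 = 0"
    and "smul m (smul k1 p1 + smul k2 p2) + smul m' (smul k1 p1 + smul k3 p3) = e" "e \<noteq> 0"
  shows "on_diagonal_line (line e) (line p1) (line p2) (line p3) (line p4)"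
proof (rule on_diagonal_lineI)
  show "smul (m * k1) p1 + smul (m * k2) p2 + smul (m * k3) p3 + smul (m * k4) p4 = 0"
    "smul (m' * k1) p1 + smul (m' * k2) p2 + smul (m' * k3) p3 + smul (m' * k4) p4 = 0"
    using assms(1) by (simp_all only: smul_0 flip: smul_smul smul_add)
  have sum: "smul (m * k1) p1 + smul (m * k2) p2 + smul (m' * k1) p1 + smul (m' * k3) p3 = e"
    using assms(2) by (simp only: smul_add smul_smul add.assoc)
  show "smul (m * k1) p1 + smul (m * k2) p2 + smul (m' * k1) p1 + smul (m' * k3) p3 \<in> line e"
    "smul (m * k1) p1 + smul (m * k2) p2 + smul (m' * k1) p1 + smul (m' * k3) p3 \<noteq> 0"
    using smul_in_line[of 1 e] assms(3) by (simp_all add: sum)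
qed (rule smul_in_line)+

lemma on_diagonal_line_conic_point:
  fixes w1 w2 w3 w4 :: "'a::{field,boolean_group} \<times> 'a"
  assumes sqrt: "\<And>x :: 'a. \<exists>a. x = a * a"
    and nonzero: "bracket w1 w2 \<noteq> 0" "bracket w1 w3 \<noteq> 0" "bracket w1 w4 \<noteq> 0"
      "bracket w2 w3 \<noteq> 0" "bracket w2 w4 \<noteq> 0" "bracket w3 w4 \<noteq> 0"
  shows "\<exists>w. w \<noteq> 0 \<and> on_diagonal_line (line (conic_point w)) (line (conic_point w1))
    (line (conic_point w2)) (line (conic_point w3)) (line (conic_point w4))"
proof -
  let ?p1 = "conic_point w1" and ?p2 = "conic_point w2" and ?p3 = "conic_point w3"
  let ?k1 = "bracket w2 w3 * bracket w2 w4 * bracket w3 w4"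
    and ?k2 = "bracket w1 w3 * bracket w1 w4 * bracket w3 w4"
    and ?k3 = "bracket w1 w2 * bracket w1 w4 * bracket w2 w4"
  obtain x y z z' where
    diagonal12: "smul (bracket w2 w3 * bracket w2 w4) ?p1 +
      smul (bracket w1 w3 * bracket w1 w4) ?p2 = smul (bracket w1 w2) (x, y, z)"
    and diagonal13: "smul (bracket w2 w3 * bracket w3 w4) ?p1 +
      smul (bracket w1 w2 * bracket w1 w4) ?p3 = smul (bracket w1 w3) (x, y, z')"
    and nucleus: "z + z' = bracket w1 w4 * bracket w2 w3"
    by (rule conic_diagonal_points)
  \<comment> \<open>The tangent that joins \<open>(x, y, z)\<close> to the nucleus touches the conic at \<open>(a\<^sup>2, b\<^sup>2, a b)\<close>.\<close>
  obtain a b where ab: "x = a * a" "y = b * b" using sqrt by metis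
  define m m' where "m = (z' + a * b) / (bracket w1 w2 * bracket w3 w4)"
    and "m' = (z + a * b) / (bracket w1 w3 * bracket w2 w4)"
  have "smul m (smul ?k1 ?p1 + smul ?k2 ?p2) + smul m' (smul ?k1 ?p1 + smul ?k3 ?p3) =
      smul (m * bracket w3 w4) (smul (bracket w1 w2) (x, y, z)) +
      smul (m' * bracket w2 w4) (smul (bracket w1 w3) (x, y, z'))"
    unfolding diagonal12[symmetric] diagonal13[symmetric]
    by (simp only: smul_add smul_smul mult_ac add_ac)
  also have "\<dots> = smul (z' + a * b) (x, y, z) + smul (z + a * b) (x, y, z')"
    using nonzero by (simp add: m_def m'_def mult_ac del: smul.simps)
  also have "\<dots> = smul (z + z') (conic_point (a, b))"
    by (simp only: ab smul.simps conic_point.simps add_Pair boolean_ring_simps)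
  finally have sum: "smul m (smul ?k1 ?p1 + smul ?k2 ?p2) + smul m' (smul ?k1 ?p1 + smul ?k3 ?p3) =
      smul (z + z') (conic_point (a, b))" .
  have "(x, y) \<noteq> 0"
    using nonzero diagonal12 by (intro conic_chord_avoids_nucleus[of w1 w2]) simp_all
  then have "(a, b) \<noteq> 0" "conic_point (a, b) \<noteq> 0" by (auto simp: ab zero_prod_def)
  moreover have "z + z' \<noteq> 0" using nonzero by (simp add: nucleus)
  ultimately show ?thesis
    using on_diagonal_line_if_relation[OF conic_point_relation sum]
    by (metis line_smul smul_eq_0_iff)
qed

lemma conic_lines: "line ` set conic_points = (\<lambda>w. line (conic_point w)) ` (- {0})"
proof (intro equalityI subsetI)
  fix L assume "L \<in> line ` set conic_points"
  then consider "L = line (0, 1, 0)" | t where "L = line (1, t, (t * t) * (t * t))"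
    by (auto simp: set_conic_points)
  then show "L \<in> (\<lambda>w. line (conic_point w)) ` (- {0})"
  proof cases
    case 1
    then show ?thesis by (intro image_eqI[of _ _ "(0, 1)"]) (simp_all add: zero_prod_def)
  next
    case (2 t)
    then have "L = line (conic_point (1, (t * t) * (t * t)))"
      by (simp only: conic_point.simps f8_power_8 mult_1_left)
    then show ?thesis by (rule image_eqI) (simp add: zero_prod_def)
  qed
next
  fix L :: "f8 triple set" assume "L \<in> (\<lambda>w. line (conic_point w)) ` (- {0})"
  then obtain w where "w \<noteq> 0" "L = line (conic_point w)" by blast
  moreover obtain u v where "w = (u, v)" by (cases w)
  ultimately have w: "(u, v) \<noteq> 0" and L: "L = line (conic_point (u, v))" by simp_all
  show "L \<in> line ` set conic_points"
  proof (cases "u = 0")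
    case True
    then have "L = line (smul (v * v) (0, 1, 0))" by (simp add: L)
    also have "\<dots> = line (0, 1, 0)" using w True by (intro line_smul) (simp add: zero_prod_def)
    finally show ?thesis by (simp add: set_conic_points)
  next
    case False
    define x where "x = v / u"
    have "L = line (smul (u * u) (1, x * x, x))" using False by (simp add: L x_def)
    also have "\<dots> = line (1, x * x, x)" using False by (simp add: line_smul del: smul.simps)
    also have "\<dots> = line (1, x * x, (x * x) * (x * x) * ((x * x) * (x * x)))"
      by (simp only: f8_power_8)
    finally show ?thesis by (simp add: set_conic_points)
  qed
qed

lemma diagonally_closed_conic: "diagonally_closed (line ` set conic_points)"
  unfolding diagonally_closed_def
proof (intro ballI impI)
  fix P Q R S
  assume "P \<in> line ` set conic_points" "Q \<in> line ` set conic_points"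
    "R \<in> line ` set conic_points" "S \<in> line ` set conic_points"
    and distinct: "distinct [P, Q, R, S]"
  then obtain w1 w2 w3 w4 where nonzero: "w1 \<noteq> 0" "w2 \<noteq> 0" "w3 \<noteq> 0" "w4 \<noteq> 0"
    and lines: "P = line (conic_point w1)" "Q = line (conic_point w2)"
      "R = line (conic_point w3)" "S = line (conic_point w4)"
    unfolding conic_lines by blast
  have "\<exists>a. x = a * a" for x :: f8
    by (rule exI[of _ "(x * x) * (x * x)"]) (rule f8_power_8[symmetric])
  moreover have "bracket w1 w2 \<noteq> 0" "bracket w1 w3 \<noteq> 0" "bracket w1 w4 \<noteq> 0"
    "bracket w2 w3 \<noteq> 0" "bracket w2 w4 \<noteq> 0" "bracket w3 w4 \<noteq> 0"
    using distinct nonzero unfolding lines by (simp_all add: bracket_neq_0)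
  ultimately obtain w where "w \<noteq> 0" "on_diagonal_line (line (conic_point w)) P Q R S"
    unfolding lines using on_diagonal_line_conic_point[of w1 w2 w3 w4] by blast
  then show "\<exists>E \<in> line ` set conic_points. on_diagonal_line E P Q R S"
    unfolding conic_lines by blast
qed

lemma pointed_conic_diagonal_points:
  fixes A :: "'a::{field,boolean_group}"
  assumes "smul k1 (0, 1, 0) + smul k2 (1, 0, 0) + smul k3 (1, 1, 1) + smul k4 (1, A, A * A) = 0"
  shows "smul k1 (0, 1, 0) + smul k2 (1, 0, 0) = smul (k4 * (1 + A)) (1 + A, A, 0)"
    "smul k1 (0, 1, 0) + smul k3 (1, 1, 1) = smul (k4 * A) (A, 1, A)"
proof -
  have eqs: "k2 + k3 + k4 = 0" "k1 + k3 + k4 * A = 0" "k3 + k4 * (A * A) = 0"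
    using assms by (simp_all add: zero_prod_def)
  have k3: "k3 = k4 * (A * A)" using eqs(3) by (simp only: add_eq_0_iff_eq)
  have k2: "k2 = k3 + k4" and k1: "k1 = k3 + k4 * A"
    using eqs(1,2) by (simp_all only: add.assoc add_eq_0_iff_eq)
  show "smul k1 (0, 1, 0) + smul k2 (1, 0, 0) = smul (k4 * (1 + A)) (1 + A, A, 0)"
    "smul k1 (0, 1, 0) + smul k3 (1, 1, 1) = smul (k4 * A) (A, 1, A)"
    unfolding k1 k2 k3 smul.simps add_Pair
    by (simp_all only: boolean_ring_simps mult_1_left mult_1_right mult_zero_left mult_zero_right)
qed

lemma no_pointed_conic_point_on_diagonal_line:
  "\<forall>e \<in> set pointed_conic_points. det (1 + alpha, alpha, 0) (alpha, 1, alpha) e \<noteq> 0"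
  by code_simp

lemma on_diagonal_line_lines:
  assumes "on_diagonal_line (line e) (line p) (line q) (line r) (line s)"
  obtains k1 k2 k3 k4 k1' k2' k3' k4' l where
    "smul k1 p + smul k2 q + smul k3 r + smul k4 s = 0"
    "smul k1' p + smul k2' q + smul k3' r + smul k4' s = 0"
    "smul k1 p + smul k2 q + smul k1' p + smul k3' r = smul l e" "smul l e \<noteq> 0"
proof -
  obtain a b c d a' b' c' d'
    where "a \<in> line p" "b \<in> line q" "c \<in> line r" "d \<in> line s"
      "a' \<in> line p" "b' \<in> line q" "c' \<in> line r" "d' \<in> line s"
      "a + b + a' + c' \<in> line e"
      and sums: "a + b + c + d = 0" "a' + b' + c' + d' = 0" "a + b + a' + c' \<noteq> 0"
    using assms unfolding on_diagonal_line_def by blast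
  then obtain k1 k2 k3 k4 k1' k2' k3' k4' l
    where "a = smul k1 p" "b = smul k2 q" "c = smul k3 r" "d = smul k4 s"
      "a' = smul k1' p" "b' = smul k2' q" "c' = smul k3' r" "d' = smul k4' s"
      "a + b + a' + c' = smul l e"
    unfolding line_def by (elim rangeE)
  then show ?thesis using sums that by simp
qed

lemma not_diagonally_closed_pointed_conic: "\<not> diagonally_closed (line ` set pointed_conic_points)"
proof
  assume closed: "diagonally_closed (line ` set pointed_conic_points)"
  define p q r s where pqrs: "p = (0 :: f8, 1 :: f8, 0 :: f8)" "q = (1 :: f8, 0 :: f8, 0 :: f8)"
    "r = (1 :: f8, 1 :: f8, 1 :: f8)" "s = (1 :: f8, alpha, alpha * alpha)"
  have point: "(1, t, t * t) \<in> set pointed_conic_points" for t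
    by (simp add: set_pointed_conic_points)
  have mem: "p \<in> set pointed_conic_points" "q \<in> set pointed_conic_points"
    "r \<in> set pointed_conic_points" "s \<in> set pointed_conic_points"
    using point[of 0] point[of 1] point[of alpha] unfolding pqrs
    by (simp_all only: mult_zero_left mult_1_left set_pointed_conic_points insertI1)
  have "distinct [p, q, r, s]"
    by (simp add: pqrs zero_f8_def one_f8_def)
  moreover have "inj_on line (set pointed_conic_points)"
    using arc_pointed_conic_points by (simp add: inj_on_line_arc)
  ultimately have "distinct [line p, line q, line r, line s]"
    using mem by (simp add: inj_on_eq_iff)
  then obtain e where e: "e \<in> set pointed_conic_points"
    and diagonal: "on_diagonal_line (line e) (line p) (line q) (line r) (line s)"
    using closed mem unfolding diagonally_closed_def by blast
  obtain k1 k2 k3 k4 k1' k2' k3' k4' l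
    where relations: "smul k1 p + smul k2 q + smul k3 r + smul k4 s = 0"
      "smul k1' p + smul k2' q + smul k3' r + smul k4' s = 0"
      and sum: "smul k1 p + smul k2 q + smul k1' p + smul k3' r = smul l e" "smul l e \<noteq> 0"
    using diagonal by (rule on_diagonal_line_lines)
  have "smul k1 p + smul k2 q = smul (k4 * (1 + alpha)) (1 + alpha, alpha, 0)"
    using relations(1) unfolding pqrs by (rule pointed_conic_diagonal_points(1))
  moreover have "smul k1' p + smul k3' r = smul (k4' * alpha) (alpha, 1, alpha)"
    using relations(2) unfolding pqrs by (rule pointed_conic_diagonal_points(2))
  ultimately have "smul (k4 * (1 + alpha)) (1 + alpha, alpha, 0) +
      smul (k4' * alpha) (alpha, 1, alpha) + smul l e = 0"
    using sum(1) by (metis add.assoc add_self)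
  then have "l = 0"
    using no_pointed_conic_point_on_diagonal_line e det_independent(3) by blast
  then show False using sum(2) by simp
qed

lemma conic_not_lin_equiv_pointed_conic:
  "\<not> lin_equiv (line ` set conic_points) (line ` set pointed_conic_points)"
  using diagonally_closed_lin_equiv diagonally_closed_conic not_diagonally_closed_pointed_conic
  by blast

section \<open>Coordinates in the model of the statement\<close>

fun gf8_of :: "f8 \<Rightarrow> gf8" where
  "gf8_of (F a b c) = (\<chi> i. if i = 0 then of_bool a else if i = 1 then of_bool b else of_bool c)"

lemma all_index3: "(\<forall>i :: 3. P i) \<longleftrightarrow> P 0 \<and> P 1 \<and> P 2"
proof -
  have "(3 :: 3) = 0" by simp
  then show ?thesis unfolding forall_3 by metis
qed

lemma bij_gf8_of: "bij gf8_of"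
proof (rule bijI)
  show "inj gf8_of"
  proof (rule injI)
    fix x y assume "gf8_of x = gf8_of y"
    then have "gf8_of x $ i = gf8_of y $ i" for i by simp
    from this[of 0] this[of 1] this[of 2] show "x = y"
      by (cases x; cases y) (simp add: of_bool_eq_iff)
  qed
  show "surj gf8_of"
  proof (rule surjI)
    show "gf8_of (F (v $ 0 = 1) (v $ 1 = 1) (v $ 2 = 1)) = v" for v :: gf8
      by (simp add: vec_eq_iff all_index3)
  qed
qed

lemma of_bool_bit: "of_bool (a \<noteq> b) = (of_bool a + of_bool b :: bit)"
  "of_bool (a \<and> b) = (of_bool a * of_bool b :: bit)"
  by (cases a; cases b; simp)+

lemma gf8_of_add: "gf8_of (x + y) = gf8_of x + gf8_of y"
proof (cases x; cases y)
  fix a b c a' b' c' assume xy: "x = F a b c" "y = F a' b' c'"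
  have "(\<chi> i. if i = 0 then p + p' else if i = 1 then q + q' else r + r') =
      (\<chi> i. if i = 0 then p else if i = 1 then q else r) +
      ((\<chi> i. if i = 0 then p' else if i = 1 then q' else r') :: gf8)" for p q r p' q' r'
    by (simp add: vec_eq_iff)
  then show ?thesis by (simp only: xy plus_f8.simps gf8_of.simps of_bool_bit)
qed

lemma gf8_of_mult: "gf8_of (x * y) = gf8_mul (gf8_of x) (gf8_of y)"
proof (cases x; cases y)
  fix a b c a' b' c' assume xy: "x = F a b c" "y = F a' b' c'"
  have "gf8_mul (\<chi> i. if i = 0 then p else if i = 1 then q else r)
      (\<chi> i. if i = 0 then p' else if i = 1 then q' else r') =
    (\<chi> i. if i = 0 then p * p' + (q * r' + r * q')
      else if i = 1 then p * q' + q * p' + (q * r' + r * q') + r * r'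
      else p * r' + q * q' + r * p' + r * r')" for p q r p' q' r'
    by (simp add: gf8_mul_def Let_def cong: if_cong)
  then show ?thesis by (simp only: xy times_f8.simps gf8_of.simps of_bool_bit)
qed

lemma gf8_of_one: "gf8_of 1 = gf8_one"
  by (simp add: one_f8_def gf8_one_def vec_eq_iff)

lemma gf8_of_zero: "gf8_of 0 = 0"
  by (simp add: zero_f8_def vec_eq_iff)

fun V_of :: "f8 triple \<Rightarrow> V" where
  "V_of (x, y, z) = vec3 (gf8_of x) (gf8_of y) (gf8_of z)"

lemma V_eq_iff: "v = w \<longleftrightarrow> v $ 0 = w $ 0 \<and> v $ 1 = w $ 1 \<and> v $ 2 = w $ 2" for v w :: V
  using vec_eq_iff[of v w] by (simp add: all_index3)

lemma bij_V_of: "bij V_of"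
proof (rule bijI)
  show "inj V_of"
  proof (rule injI)
    fix p q assume "V_of p = V_of q"
    then show "p = q"
      by (cases p; cases q) (simp add: V_eq_iff vec3_def bij_is_inj[OF bij_gf8_of, THEN inj_eq])
  qed
  show "surj V_of"
  proof (rule surjI)
    show "V_of (inv gf8_of (v $ 0), inv gf8_of (v $ 1), inv gf8_of (v $ 2)) = v" for v
      by (simp add: V_eq_iff vec3_def surj_f_inv_f[OF bij_is_surj[OF bij_gf8_of]])
  qed
qed

lemma additive_V_of: "additive V_of"
  by standard (auto simp: V_eq_iff vec3_def gf8_of_add)

lemma card_V: "card (UNIV :: V set) = 512"
proof -
  have "card (UNIV :: f8 triple set) = 512" by (simp add: card_f8 flip: UNIV_Times_UNIV)
  then show ?thesis using bij_betw_same_card[OF bij_V_of] by simp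
qed

lemma pseudo_oval_iff_generalized_oval: "pseudo_oval Ov \<longleftrightarrow> generalized_oval Ov"
proof -
  have planes: "is_plane S \<longleftrightarrow> plane S" for S
    by (simp add: is_plane_def plane_def)
  have spans: "spans_all3 A B C \<longleftrightarrow> independent3 A B C" if "plane A" "plane B" "plane C" for A B C
    using independent3_iff_spanning[OF card_V that] by (simp add: spans_all3_def)
  show ?thesis
  proof
    assume "pseudo_oval Ov"
    then show "generalized_oval Ov"
      unfolding pseudo_oval_def planes by unfold_locales (simp_all flip: spans)
  next
    assume "generalized_oval Ov"
    then interpret generalized_oval Ov .
    show "pseudo_oval Ov"
      unfolding pseudo_oval_def planes using card_eq plane independent by (simp add: spans)
  qed
qed

lemma proj_equiv_iff_lin_equiv: "proj_equiv O1 O2 \<longleftrightarrow> lin_equiv O1 O2"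
  by (simp add: proj_equiv_def lin_equiv_def additive_def)

lemma Collect_gf8_eq: "{f t | t. True} = range (\<lambda>t. f (gf8_of t))"
proof -
  have "range (\<lambda>t. f (gf8_of t)) = f ` range gf8_of" by (simp only: image_image)
  then show ?thesis by (simp add: bij_is_surj[OF bij_gf8_of] full_SetCompr_eq)
qed

lemma pt_plane_V_of: "pt_plane (V_of p) = V_of ` line p"
proof -
  obtain x y z where p: "p = (x, y, z)" by (cases p)
  have "(\<chi> i. gf8_mul (gf8_of l) (V_of p $ i)) = V_of (smul l p)" for l
    by (simp add: p V_eq_iff vec3_def gf8_of_mult)
  then show ?thesis
    unfolding pt_plane_def Collect_gf8_eq by (simp add: line_def image_image)
qed

lemma conic_eq: "conic = V_of ` set conic_points"
  unfolding conic_def Collect_gf8_eq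
  by (simp add: set_conic_points gf8_sqrt_def gf8_sq_def gf8_of_mult gf8_of_one gf8_of_zero
      image_image)

lemma pointed_conic_eq: "pointed_conic = V_of ` set pointed_conic_points"
  unfolding pointed_conic_def Collect_gf8_eq
  by (simp add: set_pointed_conic_points gf8_sq_def gf8_of_mult gf8_of_one gf8_of_zero image_image)

lemma lin_equiv_elementary: "lin_equiv (line ` K) (elementary (V_of ` K))"
  by (rule lin_equivI[OF bij_V_of additive_V_of])
    (simp add: elementary_def image_image pt_plane_V_of)

theorem theorem5:
  shows "pseudo_oval (elementary conic) \<and> pseudo_oval (elementary pointed_conic) \<and>
         \<not> proj_equiv (elementary conic) (elementary pointed_conic) \<and>
         (\<forall>Ov. pseudo_oval Ov \<longrightarrow>
              proj_equiv Ov (elementary conic) \<or> proj_equiv Ov (elementary pointed_conic))"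
  unfolding pseudo_oval_iff_generalized_oval proj_equiv_iff_lin_equiv
proof (intro conjI allI impI)
  have conic: "lin_equiv (line ` set conic_points) (elementary conic)"
    and pointed: "lin_equiv (line ` set pointed_conic_points) (elementary pointed_conic)"
    unfolding conic_eq pointed_conic_eq by (rule lin_equiv_elementary)+
  show "generalized_oval (elementary conic)" "generalized_oval (elementary pointed_conic)"
    using generalized_oval_lin_equiv conic pointed generalized_oval_arc
      arc_conic_points arc_pointed_conic_points by blast+
  show "\<not> lin_equiv (elementary conic) (elementary pointed_conic)"
    using conic_not_lin_equiv_pointed_conic conic pointed lin_equiv_sym lin_equiv_trans by metis
  show "lin_equiv Ov (elementary conic) \<or> lin_equiv Ov (elementary pointed_conic)"
    if "generalized_oval Ov" for Ov :: "V set set"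
    using generalized_oval_classification[OF card_V that] conic pointed lin_equiv_trans by metis
qed

end
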